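(* Let $G$ be a finite irreducible complex reflection group, let $R_{a_1}^G,\ldots,R_{a_m}^G$ be the distinct $G$-conjugation orbits of the reflection subgroups for its roots, and let $k_j=|R_{a_j}|$. Then the lattice of normal reflection subgroups of $G$ is isomorphic to the lattice of divisors of $(k_1,\ldots,k_m)$ (tuples $\alpha=(\alpha_1,\ldots,\alpha_m)$ of positive integers with $\alpha_j\mid k_j$ for all $j$, ordered by coordinatewise divisibility), via $\alpha\mapsto G^\alpha$, with operations $$G^\alpha\wedge G^\beta=G^{\gcd(\alpha,\beta)},\qquad G^\alpha\vee G^\beta=G^\alpha G^\beta=G^{\mathrm{lcm}(\alpha,\beta)},$$ where $\gcd$ and $\mathrm{lcm}$ are taken coordinatewise. In particular, there are $$\sigma_0(k_1)\sigma_0(k_2)\cdots\sigma_0(k_m)$$ normal reflection subgroups of $G$, where $\sigma_0(n)$ is the number of divisors of $n$. Moreover, if $G$ is primitive, then every nontrivial normal reflection subgroup of $G$ is irreducible.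
   Context: A reflection on $\mathbb{C}^d$ is an invertible linear map $g$ with $\mathrm{rank}(I-g)=1$; a complex reflection group is a finite group generated by reflections, taken to be unitary. A reflection subgroup is a subgroup generated by reflections (the trivial group included). The root line of a unitary reflection is the orthogonal complement of its fixed hyperplane; a root $a$ is a nonzero vector in it. $R_a$ denotes the subgroup of $G$ consisting of the identity and all reflections in $G$ with root line spanned by $a$; it is cyclic, and $gR_ag^{-1}=R_{ga}$ for $g\in G$; $R_a^G=\{gR_ag^{-1}:g\in G\}$. For $\alpha_j\mid k_j$, let $\hat R_{a_j}$ be the unique subgroup of $R_{a_j}$ of order $\alpha_j$; then $G^\alpha=G^{(\alpha_1,\ldots,\alpha_m)}$ is the subgroup generated by all $G$-conjugates of $\hat R_{a_1},\ldots,\hat R_{a_m}$. Normal reflection subgroups are ordered by inclusion; join is the group generated by both groups, and meet is the group generated by the reflections in common. Primitive means irreducible with no nontrivial system of imprimitivity. *)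

theory Defs
  imports "HOL-Analysis.Analysis" "HOL-Algebra.Generated_Groups" "HOL-Algebra.Lattice"
begin

definition GL :: "(complex^'d^'d) monoid" where
  "GL = \<lparr>carrier = {A. invertible A}, mult = (**), one = mat 1\<rparr>"

lemma group_GL: "group (GL :: (complex^'d^'d) monoid)"
proof (rule groupI)
  fix A B :: "complex^'d^'d"
  assume "A \<in> carrier GL" "B \<in> carrier GL"
  then show "A \<otimes>\<^bsub>GL\<^esub> B \<in> carrier GL"
    by (simp add: GL_def invertible_mult)
next
  show "\<one>\<^bsub>GL\<^esub> \<in> carrier (GL :: (complex^'d^'d) monoid)"
    by (auto simp: GL_def invertible_def)
next
  fix A :: "complex^'d^'d"
  assume "A \<in> carrier GL"
  then obtain B where "A ** B = mat 1" "B ** A = mat 1"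
    by (auto simp: GL_def invertible_def)
  then show "\<exists>B\<in>carrier GL. B \<otimes>\<^bsub>GL\<^esub> A = \<one>\<^bsub>GL\<^esub>"
    by (auto simp: GL_def invertible_def)
qed (auto simp: GL_def matrix_mul_assoc)

text \<open>The \<open>inner\<close> of the library on \<open>complex^'d\<close> is the real part of the following Hermitian form.\<close>

definition herm :: "complex^'d \<Rightarrow> complex^'d \<Rightarrow> complex" where
  "herm v w = (\<Sum>i\<in>UNIV. v $ i * cnj (w $ i))"

definition unitary :: "complex^'d^'d \<Rightarrow> bool" where
  "unitary A \<longleftrightarrow> invertible A \<and> (\<forall>v w. herm (A *v v) (A *v w) = herm v w)"

definition reflection :: "complex^'d^'d \<Rightarrow> bool" where
  "reflection g \<longleftrightarrow> invertible g \<and> rank (mat 1 - g) = 1"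

text \<open>\<open>S = {}\<close> is allowed and gives the trivial group.\<close>

definition generated_by_reflections :: "(complex^'d^'d) set \<Rightarrow> bool" where
  "generated_by_reflections H \<longleftrightarrow> (\<exists>S \<subseteq> {g. reflection g}. H = generate GL S)"

definition complex_reflection_group :: "(complex^'d^'d) set \<Rightarrow> bool" where
  "complex_reflection_group G \<longleftrightarrow>
     finite G \<and> (\<forall>g\<in>G. unitary g) \<and> generated_by_reflections G"

text \<open>Subspaces are complex subspaces: \<open>vec.subspace\<close> refers to the scaling \<open>(*s)\<close>, whereas
  the unqualified \<open>subspace\<close> would mean real subspaces.\<close>

definition irreducible_group :: "(complex^'d^'d) set \<Rightarrow> bool" where
  "irreducible_group G \<longleftrightarrow>
     (\<forall>W :: (complex^'d) set. vec.subspace W \<and> (\<forall>g\<in>G. \<forall>w\<in>W. g *v w \<in> W) \<longrightarrow> W = {0} \<or> W = UNIV)"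

text \<open>A system of imprimitivity is a finite set of nonzero subspaces with direct sum the whole
  space that is permuted by the group; the trivial system is \<open>{UNIV}\<close>.\<close>

definition system_of_imprimitivity ::
    "(complex^'d^'d) set \<Rightarrow> (complex^'d) set set \<Rightarrow> bool" where
  "system_of_imprimitivity G \<V> \<longleftrightarrow>
     finite \<V> \<and> (\<forall>V\<in>\<V>. vec.subspace V \<and> V \<noteq> {0}) \<and>
     (\<forall>v. \<exists>!f. f \<in> (\<Pi>\<^sub>E V\<in>\<V>. V) \<and> v = (\<Sum>V\<in>\<V>. f V)) \<and>
     (\<forall>g\<in>G. \<forall>V\<in>\<V>. (*v) g ` V \<in> \<V>)"

definition primitive_group :: "(complex^'d^'d) set \<Rightarrow> bool" where
  "primitive_group G \<longleftrightarrow>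
     irreducible_group G \<and> (\<forall>\<V>. system_of_imprimitivity G \<V> \<longrightarrow> \<V> = {UNIV})"

definition root_line :: "complex^'d^'d \<Rightarrow> (complex^'d) set" where
  "root_line g = {v. \<forall>w. g *v w = w \<longrightarrow> herm v w = 0}"

definition group_roots :: "(complex^'d^'d) set \<Rightarrow> (complex^'d) set" where
  "group_roots G = {a. a \<noteq> 0 \<and> (\<exists>g\<in>G. reflection g \<and> a \<in> root_line g)}"

definition refl_subgroup :: "(complex^'d^'d) set \<Rightarrow> complex^'d \<Rightarrow> (complex^'d^'d) set" where
  "refl_subgroup G a = {mat 1} \<union> {g\<in>G. reflection g \<and> root_line g = vec.span {a}}"

definition conjugate :: "complex^'d^'d \<Rightarrow> (complex^'d^'d) set \<Rightarrow> (complex^'d^'d) set" where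
  "conjugate g H = (g <#\<^bsub>GL\<^esub> H) #>\<^bsub>GL\<^esub> (inv\<^bsub>GL\<^esub> g)"

definition conj_orbit ::
    "(complex^'d^'d) set \<Rightarrow> (complex^'d^'d) set \<Rightarrow> (complex^'d^'d) set set" where
  "conj_orbit G H = {conjugate g H | g. g \<in> G}"

text \<open>The unique subgroup of order \<open>n\<close> of the cyclic group \<open>refl_subgroup G a\<close>; meaningful only if
  \<open>n\<close> divides the order of the latter.\<close>

definition refl_subgroup_of_order ::
    "(complex^'d^'d) set \<Rightarrow> complex^'d \<Rightarrow> nat \<Rightarrow> (complex^'d^'d) set" where
  "refl_subgroup_of_order G a n =
     (THE H. subgroup H (GL\<lparr>carrier := refl_subgroup G a\<rparr>) \<and> card H = n)"

text \<open>\<open>normal_power G m a \<alpha>\<close> is the group written $G^{\alpha}$; only the values of \<open>\<alpha>\<close> on \<open>{1..m}\<close> matter.\<close>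

definition normal_power ::
    "(complex^'d^'d) set \<Rightarrow> nat \<Rightarrow> (nat \<Rightarrow> complex^'d) \<Rightarrow> (nat \<Rightarrow> nat) \<Rightarrow> (complex^'d^'d) set" where
  "normal_power G m a \<alpha> =
     generate GL (\<Union>j\<in>{1..m}. \<Union>g\<in>G. conjugate g (refl_subgroup_of_order G (a j) (\<alpha> j)))"

definition normal_reflection_subgroups :: "(complex^'d^'d) set \<Rightarrow> (complex^'d^'d) set set" where
  "normal_reflection_subgroups G = {N. N \<lhd> GL\<lparr>carrier := G\<rparr> \<and> generated_by_reflections N}"

definition nrs_order :: "(complex^'d^'d) set \<Rightarrow> (complex^'d^'d) set gorder" where
  "nrs_order G = \<lparr>carrier = normal_reflection_subgroups G, eq = (=), le = (\<subseteq>)\<rparr>"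

definition nrs_join ::
    "(complex^'d^'d) set \<Rightarrow> (complex^'d^'d) set \<Rightarrow> (complex^'d^'d) set" where
  "nrs_join M N = generate GL (M \<union> N)"

definition nrs_meet ::
    "(complex^'d^'d) set \<Rightarrow> (complex^'d^'d) set \<Rightarrow> (complex^'d^'d) set" where
  "nrs_meet M N = generate GL {g \<in> M \<inter> N. reflection g}"

text \<open>The tuples indexed by \<open>{1..m}\<close> are represented by extensional functions, so that each tuple
  has exactly one representative.\<close>

definition divisor_tuples :: "nat \<Rightarrow> (nat \<Rightarrow> nat) \<Rightarrow> (nat \<Rightarrow> nat) set" where
  "divisor_tuples m k = (\<Pi>\<^sub>E j\<in>{1..m}. {d. 0 < d \<and> d dvd k j})"

definition divisor_order :: "nat \<Rightarrow> (nat \<Rightarrow> nat) \<Rightarrow> (nat \<Rightarrow> nat) gorder" where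
  "divisor_order m k =
     \<lparr>carrier = divisor_tuples m k, eq = (=), le = (\<lambda>\<alpha> \<beta>. \<forall>j\<in>{1..m}. \<alpha> j dvd \<beta> j)\<rparr>"

definition gcd_tuple :: "nat \<Rightarrow> (nat \<Rightarrow> nat) \<Rightarrow> (nat \<Rightarrow> nat) \<Rightarrow> nat \<Rightarrow> nat" where
  "gcd_tuple m \<alpha> \<beta> = (\<lambda>j\<in>{1..m}. gcd (\<alpha> j) (\<beta> j))"

definition lcm_tuple :: "nat \<Rightarrow> (nat \<Rightarrow> nat) \<Rightarrow> (nat \<Rightarrow> nat) \<Rightarrow> nat \<Rightarrow> nat" where
  "lcm_tuple m \<alpha> \<beta> = (\<lambda>j\<in>{1..m}. lcm (\<alpha> j) (\<beta> j))"

definition lattice_iso ::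
    "('a \<Rightarrow> 'b) \<Rightarrow> 'a gorder \<Rightarrow> 'b gorder \<Rightarrow> bool" where
  "lattice_iso f K L \<longleftrightarrow>
     lattice K \<and> lattice L \<and> bij_betw f (carrier K) (carrier L) \<and>
     (\<forall>x\<in>carrier K. \<forall>y\<in>carrier K. x \<sqsubseteq>\<^bsub>K\<^esub> y \<longleftrightarrow> f x \<sqsubseteq>\<^bsub>L\<^esub> f y)"

definition sigma0 :: "nat \<Rightarrow> nat" where
  "sigma0 n = card {d. d dvd n}"

end

(*
  Every reflection of G is conjugate to an element of exactly one R_{a_j}.  The
  orbit of the line of a_j carries a linear character of G, the product of the entries of the monomial
  matrix by which G permutes (up to scalars) vectors chosen on the lines of the orbit.  It maps a
  reflection to its nontrivial eigenvalue if its root line lies in the orbit and to 1 otherwise.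
  On G^alpha its values are therefore alpha_j-th roots of unity, so that the reflections in G^alpha
  are only the obvious ones; this makes alpha |-> G^alpha an order embedding.  It is onto because a
  normal reflection subgroup N is recovered from the orders of the groups N Int R_{a_j}, and the
  formulas for joins and meets follow formally.

  The spans of the connected components of the non-orthogonality graph on the roots of N are
  permuted by G and are an orthogonal decomposition of the space.  If G is primitive, there is only
  one component, and a subspace invariant under N contains all of its roots or is orthogonal to them.
*)

theory Submission
  imports Defs
begin

text \<open>The delicate point is that a product of generators of \<open>G^alpha\<close> might be a
  reflection in some \<open>R_{a_j}\<close> whose order does not divide \<open>alpha_j\<close>.
  Words in the generators give no control over this, and the determinant sees all orbits at once, so
  each orbit needs a character of its own. In the symmetric algebra, an element of G multiplies the
  product of the vectors chosen on the lines of an orbit by a scalar, and that scalar is the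
  character; collecting coefficients line by line defines it without polynomials. It does not depend
  on the chosen vectors, so its value at a reflection may be computed with vectors adapted to that
  reflection. Within a single \<open>R_a\<close> the eigenvalue on the root identifies the group
  with a group of complex roots of unity. Subgroups are then determined by their orders and
  inclusion becomes divisibility, which is how divisor tuples enter.\<close>

interpretation GL: group "GL :: (complex^'d^'d) monoid"
  by (rule group_GL)

section \<open>Matrix arithmetic in \<open>GL\<close> and conjugation of sets of matrices\<close>

lemma GL_simps [simp]:
  "x \<otimes>\<^bsub>GL\<^esub> y = x ** y" "\<one>\<^bsub>GL\<^esub> = mat 1" "x \<in> carrier GL \<longleftrightarrow> invertible x"
  by (auto simp: GL_def)

lemma GL_inv_matrix_mult:
  assumes "invertible x"
  shows "inv\<^bsub>GL\<^esub> x ** x = mat 1" "x ** inv\<^bsub>GL\<^esub> x = mat 1" "invertible (inv\<^bsub>GL\<^esub> x)"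
  using GL.l_inv[of x] GL.r_inv[of x] GL.inv_closed[of x] assms by auto

lemma GL_inv_vector_mult:
  assumes "invertible x"
  shows "inv\<^bsub>GL\<^esub> x *v (x *v v) = v" "x *v (inv\<^bsub>GL\<^esub> x *v v) = v"
  using GL_inv_matrix_mult[OF assms] by (simp_all add: matrix_vector_mul_assoc)

lemma invertible_vector_mult_eq_0:
  fixes x :: "complex^'d^'d"
  assumes "invertible x"
  shows "x *v v = 0 \<longleftrightarrow> v = 0"
  by (metis GL_inv_vector_mult(1) assms matrix_vector_mult_0_right)

lemma invertible_vector_mult_inj:
  fixes x :: "complex^'d^'d"
  assumes "invertible x"
  shows "inj ((*v) x)"
  by (metis GL_inv_vector_mult(1) assms injI)

lemma subgroup_GL_iff:
  "subgroup H GL \<longleftrightarrow> (\<forall>x\<in>H. invertible x) \<and> mat 1 \<in> H \<and>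
     (\<forall>x\<in>H. \<forall>y\<in>H. x ** y \<in> H) \<and> (\<forall>x\<in>H. inv\<^bsub>GL\<^esub> x \<in> H)"
  by (auto simp: subgroup_def subset_iff)

lemma subgroup_GL_D:
  assumes "subgroup H GL"
  shows "x \<in> H \<Longrightarrow> invertible x" "mat 1 \<in> H" "x \<in> H \<Longrightarrow> y \<in> H \<Longrightarrow> x ** y \<in> H"
    "x \<in> H \<Longrightarrow> inv\<^bsub>GL\<^esub> x \<in> H"
  using assms by (auto simp: subgroup_GL_iff)

lemma conjugate_eq: "conjugate g H = (\<lambda>h. g ** h ** inv\<^bsub>GL\<^esub> g) ` H"
  by (auto simp: conjugate_def l_coset_def r_coset_def)

lemma conjugate_vector_mult:
  assumes "invertible x"
  shows "(x ** g ** inv\<^bsub>GL\<^esub> x) *v (x *v w) = x *v (g *v w)"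
  using GL_inv_vector_mult[OF assms] by (simp add: matrix_vector_mul_assoc[symmetric])

lemma conjugate_conjugate:
  assumes "invertible g" "invertible h" "\<And>x. x \<in> H \<Longrightarrow> invertible x"
  shows "conjugate g (conjugate h H) = conjugate (g ** h) H"
proof -
  have "inv\<^bsub>GL\<^esub> (g ** h) = inv\<^bsub>GL\<^esub> h ** inv\<^bsub>GL\<^esub> g"
    using GL.inv_mult_group[of g h] assms by simp
  then show ?thesis
    by (simp add: conjugate_eq image_image matrix_mul_assoc)
qed

lemma conjugate_inv_cancel:
  fixes g x :: "complex^'d^'d"
  assumes "invertible g"
  shows "g ** (inv\<^bsub>GL\<^esub> g ** x ** g) ** inv\<^bsub>GL\<^esub> g = x"
    "inv\<^bsub>GL\<^esub> g ** (g ** x ** inv\<^bsub>GL\<^esub> g) ** g = x"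
  by (metis GL_inv_matrix_mult(1,2) assms matrix_mul_assoc matrix_mul_lid matrix_mul_rid)+

section \<open>The Hermitian form\<close>

lemma herm_add: "herm (u + v) w = herm u w + herm v w" "herm w (u + v) = herm w u + herm w v"
  by (simp_all add: herm_def sum.distrib algebra_simps)

lemma herm_diff: "herm (u - v) w = herm u w - herm v w" "herm w (u - v) = herm w u - herm w v"
  by (simp_all add: herm_def sum_subtractf algebra_simps)

lemma herm_scale: "herm (c *s v) w = c * herm v w" "herm v (c *s w) = cnj c * herm v w"
  by (simp_all add: herm_def sum_distrib_left mult.assoc mult.left_commute)

lemma herm_zero [simp]: "herm 0 w = 0" "herm w 0 = 0"
  by (simp_all add: herm_def)

lemma herm_sum: "herm (\<Sum>i\<in>I. f i) w = (\<Sum>i\<in>I. herm (f i) w)"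
  by (induction I rule: infinite_finite_induct) (simp_all add: herm_add)

lemma herm_commute: "herm w v = cnj (herm v w)"
  by (simp add: herm_def mult.commute)

lemma herm_eq_0_commute: "herm v w = 0 \<longleftrightarrow> herm w v = 0"
  by (metis complex_cnj_zero_iff herm_commute)

lemma herm_self: "herm v v = of_real (\<Sum>i\<in>UNIV. (cmod (v $ i))\<^sup>2)"
  unfolding herm_def of_real_sum by (simp only: complex_norm_square)

lemma herm_self_eq_0 [simp]: "herm v v = 0 \<longleftrightarrow> v = 0"
  by (simp add: herm_self sum_nonneg_eq_0_iff vec_eq_iff del: of_real_sum of_real_power)

lemma subspace_herm_left: "vec.subspace {v. herm v w = 0}"
  by (intro vec.subspaceI) (auto simp: herm_add herm_scale)

lemma span_herm_orthogonal:
  assumes "\<And>u v. u \<in> A \<Longrightarrow> v \<in> B \<Longrightarrow> herm u v = 0" "x \<in> vec.span A" "y \<in> vec.span B"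
  shows "herm x y = 0"
proof -
  have "vec.span B \<subseteq> {v. herm v u = 0}" if "u \<in> A" for u
    using that assms(1) herm_eq_0_commute by (intro vec.span_minimal subspace_herm_left) blast
  then have "herm u y = 0" if "u \<in> A" for u
    using that assms(3) herm_eq_0_commute by blast
  then have "vec.span A \<subseteq> {v. herm v y = 0}"
    by (intro vec.span_minimal subspace_herm_left) auto
  then show ?thesis
    using assms(2) by auto
qed

section \<open>Matrices acting on spans and lines\<close>

lemma vector_mult_scale:
  fixes x :: "complex^'d^'d"
  shows "x *v (c *s v) = c *s (x *v v)"
  by (simp add: vector_scalar_commute)

lemma vector_mult_span_image:
  fixes x :: "complex^'d^'d"
  shows "(*v) x ` vec.span S = vec.span ((*v) x ` S)"
  by (simp add: vec.span_image matrix_vector_mul_linear_gen)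

lemma mem_span_singleton: "(v :: complex^'d) \<in> vec.span {b} \<longleftrightarrow> (\<exists>c. v = c *s b)"
  by (auto simp: vec.span_singleton)

lemma span_singleton_eqI:
  fixes u :: "complex^'d"
  assumes "u \<in> vec.span {b}" "u \<noteq> 0"
  shows "vec.span {u} = vec.span {b}"
proof -
  obtain c where c: "u = c *s b" "c \<noteq> 0"
    using assms by (auto simp: mem_span_singleton)
  then have "b = (1 / c) *s u"
    by simp
  with c show ?thesis
    by (intro subset_antisym vec.span_minimal vec.subspace_span)
      (auto simp: mem_span_singleton intro: exI[of _ c] exI[of _ "1 / c"])
qed

section \<open>Unitary reflections\<close>

text \<open>For \<open>z \<noteq> 1\<close> this is the unitary reflection with root \<open>b\<close> and eigenvalue \<open>z\<close>, if \<open>z\<close> has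
  modulus \<open>1\<close>; \<open>z = 1\<close> gives the identity.\<close>

definition refl_with :: "complex^'d \<Rightarrow> complex \<Rightarrow> complex^'d^'d \<Rightarrow> bool" where
  "refl_with b z g \<longleftrightarrow> (\<forall>w. g *v w = w + ((z - 1) * herm w b / herm b b) *s b)"

lemma refl_withD: "refl_with b z g \<Longrightarrow> g *v w = w + ((z - 1) * herm w b / herm b b) *s b"
  by (simp add: refl_with_def)

lemma refl_with_one: "refl_with b 1 g \<longleftrightarrow> g = mat 1"
  by (auto simp: refl_with_def matrix_eq)

lemma refl_with_unique: "refl_with b z g \<Longrightarrow> refl_with b z h \<Longrightarrow> g = h"
  by (simp add: refl_with_def matrix_eq)

lemma refl_with_root: "refl_with b z g \<Longrightarrow> b \<noteq> 0 \<Longrightarrow> g *v b = z *s b"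
  by (simp add: refl_withD vec.scale_left_diff_distrib)

lemma refl_with_fixed_iff:
  assumes "refl_with b z g" "b \<noteq> 0" "z \<noteq> 1"
  shows "g *v w = w \<longleftrightarrow> herm w b = 0"
  using assms by (simp add: refl_withD)

text \<open>The argument of \<open>g\<close> is the value at \<open>w\<close> of the map with the
  same root and eigenvalue \<open>y\<close>, so eigenvalues multiply. Products and inverses of
  reflections with a common root both come from this computation.\<close>

lemma refl_with_vector_mult:
  assumes "refl_with b z g" "b \<noteq> 0"
  shows "g *v (w + ((y - 1) * herm w b / herm b b) *s b) = w + ((z * y - 1) * herm w b / herm b b) *s b"
proof -
  have "g *v (w + ((y - 1) * herm w b / herm b b) *s b)
      = w + ((y - 1) * herm w b / herm b b + (z - 1) * (herm w b + (y - 1) * herm w b) / herm b b) *s b"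
    using assms by (simp add: refl_withD herm_add herm_scale vec.scale_left_distrib)
  also have "(y - 1) * herm w b / herm b b + (z - 1) * (herm w b + (y - 1) * herm w b) / herm b b
      = (z * y - 1) * herm w b / herm b b"
    by (simp only: add_divide_distrib[symmetric]) (simp add: algebra_simps)
  finally show ?thesis .
qed

lemma refl_with_mult:
  assumes "refl_with b z g" "refl_with b y h" "b \<noteq> 0"
  shows "refl_with b (z * y) (g ** h)"
  unfolding refl_with_def
proof
  fix w
  show "(g ** h) *v w = w + ((z * y - 1) * herm w b / herm b b) *s b"
    using refl_with_vector_mult[OF assms(1,3), of w y] refl_withD[OF assms(2), of w]
    by (simp only: matrix_vector_mul_assoc[symmetric])
qed

lemma refl_with_nonzero:
  assumes "refl_with b z g" "b \<noteq> 0" "invertible g"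
  shows "z \<noteq> 0"
proof
  assume "z = 0"
  then have "g *v b = 0"
    using refl_with_root[OF assms(1,2)] by simp
  then show False
    using invertible_vector_mult_eq_0[OF assms(3)] assms(2) by blast
qed

lemma refl_with_inv:
  assumes "refl_with b z g" "b \<noteq> 0" "invertible g"
  shows "refl_with b (1 / z) (inv\<^bsub>GL\<^esub> g)"
  unfolding refl_with_def
proof
  fix w
  have z: "z \<noteq> 0"
    using assms by (rule refl_with_nonzero)
  have "g *v (w + ((1 / z - 1) * herm w b / herm b b) *s b) = w"
    unfolding refl_with_vector_mult[OF assms(1,2)] using z by simp
  from arg_cong[OF this, of "(*v) (inv\<^bsub>GL\<^esub> g)"]
  show "inv\<^bsub>GL\<^esub> g *v w = w + ((1 / z - 1) * herm w b / herm b b) *s b"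
    by (simp only: GL_inv_vector_mult(1)[OF assms(3)])
qed

lemma refl_with_conjugate:
  assumes "refl_with b z g" "unitary x"
  shows "refl_with (x *v b) z (x ** g ** inv\<^bsub>GL\<^esub> x)"
  unfolding refl_with_def
proof
  fix w
  have x: "invertible x" "\<And>v w. herm (x *v v) (x *v w) = herm v w"
    using assms(2) by (auto simp: unitary_def)
  define u where "u = inv\<^bsub>GL\<^esub> x *v w"
  have w: "w = x *v u"
    using x(1) by (simp add: u_def GL_inv_vector_mult)
  show "(x ** g ** inv\<^bsub>GL\<^esub> x) *v w = w + ((z - 1) * herm w (x *v b) / herm (x *v b) (x *v b)) *s (x *v b)"
    unfolding w conjugate_vector_mult[OF x(1)]
    by (simp add: x(2) refl_withD[OF assms(1)] matrix_vector_right_distrib vector_mult_scale)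
qed

text \<open>The formula is homogeneous of degree zero in the root: the factor
  \<open>t * cnj t\<close> cancels against the denominator. So only the root line matters.\<close>

lemma refl_with_scale:
  assumes "refl_with b z g" "t \<noteq> 0"
  shows "refl_with (t *s b) z g"
  using assms by (simp add: refl_with_def herm_scale)

lemma refl_with_span:
  assumes "refl_with b z g" "vec.span {c} = vec.span {b}" "c \<noteq> 0"
  shows "refl_with c z g"
proof -
  have "c \<in> vec.span {b}"
    using assms(2) by (metis insertI1 vec.span_base)
  then obtain t where "c = t *s b"
    by (auto simp: mem_span_singleton)
  then show ?thesis
    using assms by (auto intro: refl_with_scale)
qed

lemma refl_with_reflection:
  assumes "refl_with b z g" "b \<noteq> 0" "z \<noteq> 1" "invertible g"
  shows "reflection g" "root_line g = vec.span {b}"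
proof -
  \<comment> \<open>\<open>mat 1 - g\<close> sends \<open>w\<close> to
    \<open>(c * herm w b) *s b\<close>; as a matrix it is the outer product of \<open>c *s b\<close>
    with the conjugate \<open>r\<close> of \<open>b\<close>, so all its rows are multiples of
    \<open>r\<close>.\<close>
  define c where "c = (1 - z) / herm b b"
  define r :: "complex^'a" where "r = (\<chi> j. cnj (b $ j))"
  have nz: "c \<noteq> 0" "r \<noteq> 0"
    using assms by (auto simp: c_def r_def vec_eq_iff)
  have "(mat 1 - g) *v w = (\<chi> i. c * b $ i *s r) *v w" for w
  proof -
    have "(mat 1 - g) *v w = (c * herm w b) *s b"
      by (simp add: matrix_vector_mult_diff_rdistrib refl_withD[OF assms(1)] c_def
          minus_divide_left flip: vec.scale_minus_left mult_minus_left)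
    also have "\<dots> = (\<chi> i. c * b $ i *s r) *v w"
      by (simp add: vec_eq_iff matrix_vector_mult_def r_def herm_def sum_distrib_left
          sum_distrib_right mult_ac)
    finally show ?thesis .
  qed
  then have eq: "mat 1 - g = (\<chi> i. c * b $ i *s r)"
    by (simp add: matrix_eq)
  have rows: "rows (mat 1 - g) = {(c * b $ i) *s r | i. True}"
    by (auto simp: eq rows_def row_def vec_eq_iff)
  obtain i where i: "b $ i \<noteq> 0"
    using assms(2) by (auto simp: vec_eq_iff)
  have "vec.span (rows (mat 1 - g)) = vec.span {r}"
  proof
    show "vec.span (rows (mat 1 - g)) \<subseteq> vec.span {r}"
      by (intro vec.span_minimal) (auto simp: rows mem_span_singleton)
    have "r = (1 / (c * b $ i)) *s ((c * b $ i) *s r)"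
      using i nz by simp
    then have "r \<in> vec.span (rows (mat 1 - g))"
      unfolding rows using vec.span_base vec.span_scale by (metis (mono_tags, lifting) mem_Collect_eq)
    then show "vec.span {r} \<subseteq> vec.span (rows (mat 1 - g))"
      by (intro vec.span_minimal) auto
  qed
  then have "rank (mat 1 - g) = vec.dim {r}"
    by (metis row_rank_def_gen vec.dim_span)
  also have "\<dots> = 1"
    using nz by (simp add: vec.dim_eq_card_independent)
  finally show "reflection g"
    using assms(4) by (simp add: reflection_def)
  show "root_line g = vec.span {b}"
  proof (intro equalityI subsetI)
    fix v assume v: "v \<in> root_line g"
    \<comment> \<open>The part of \<open>v\<close> orthogonal to \<open>b\<close> is fixed by
      \<open>g\<close>, so it is orthogonal to \<open>v\<close> as well as to \<open>b\<close>,
      hence to itself.\<close>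
    define w where "w = v - (herm v b / herm b b) *s b"
    have w: "herm w b = 0"
      using assms(2) by (simp add: w_def herm_diff herm_scale)
    then have "herm v w = 0"
      using v assms by (simp add: root_line_def refl_with_fixed_iff)
    moreover have "herm b w = 0"
      using w herm_eq_0_commute by blast
    ultimately have "herm w w = 0"
      by (subst (1) w_def) (simp add: herm_diff herm_scale)
    then have "w = 0"
      by simp
    then show "v \<in> vec.span {b}"
      by (auto simp: w_def mem_span_singleton)
  next
    fix v assume "v \<in> vec.span {b}"
    then show "v \<in> root_line g"
      using assms by (auto simp: root_line_def mem_span_singleton refl_with_fixed_iff herm_scale
          herm_eq_0_commute[of b])
  qed
qed

text \<open>A matrix of rank one is an outer product, so \<open>g\<close> subtracts
  \<open>\<phi> w *s u\<close> from \<open>w\<close> for a linear form \<open>\<phi>\<close>.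
  Unitarity makes the kernel of \<open>\<phi>\<close> orthogonal to \<open>u\<close>, and so
  \<open>\<phi>\<close> is a multiple of the pairing with \<open>u\<close>.\<close>

lemma reflection_refl_with:
  assumes "unitary g" "reflection g"
  obtains b z where "b \<noteq> 0" "z \<noteq> 1" "refl_with b z g"
proof -
  obtain B where B: "B \<subseteq> rows (mat 1 - g)" "vec.independent B" "rows (mat 1 - g) \<subseteq> vec.span B"
    "card B = 1"
    using vec.basis_exists[of "rows (mat 1 - g)"] assms(2) by (auto simp: reflection_def row_rank_def_gen)
  then obtain r where r: "B = {r}"
    by (auto simp: card_1_singleton_iff)
  have "r \<noteq> 0"
    using B(2) r by (metis insertI1 vec.dependent_zero)
  have "\<forall>i. \<exists>c. row i (mat 1 - g) = c *s r"
    using B(3) by (auto simp: r rows_def mem_span_singleton)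
  then obtain c where c: "\<And>i. row i (mat 1 - g) = c i *s r"
    by metis
  define u where "u = (\<chi> i. c i)"
  define \<phi> where "\<phi> w = (\<Sum>j\<in>UNIV. r $ j * w $ j)" for w :: "complex^'a"
  have \<phi>: "\<phi> (w - t *s v) = \<phi> w - t * \<phi> v" for t v w
    by (simp add: \<phi>_def sum_subtractf sum_distrib_left algebra_simps)
  have entry: "(mat 1 - g) $ i $ j = c i * r $ j" for i j
    using c[of i] by (simp add: row_def vec_eq_iff)
  have "(mat 1 - g) *v w = \<phi> w *s u" for w
    by (simp add: vec_eq_iff matrix_vector_mult_def entry \<phi>_def u_def sum_distrib_left mult_ac
        del: vector_minus_component)
  then have g: "g *v w = w - \<phi> w *s u" for w
    by (metis add_diff_cancel_left' diff_add_cancel matrix_vector_mul_lid matrix_vector_mult_diff_rdistrib)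
  \<comment> \<open>The basis vector \<open>r\<close> was taken among the rows, so some coefficient
    \<open>c i\<close> is 1, which keeps \<open>u\<close> from vanishing.\<close>
  obtain i where "r = row i (mat 1 - g)"
    using B(1) r by (auto simp: rows_def)
  then have u: "u \<noteq> 0"
    using \<open>r \<noteq> 0\<close> c[of i] by (metis u_def vec.scale_zero_left vec_lambda_beta zero_index)
  obtain j where "r $ j \<noteq> 0"
    using \<open>r \<noteq> 0\<close> by (auto simp: vec_eq_iff)
  moreover have "\<phi> (axis j 1) = (\<Sum>k\<in>UNIV. if k = j then r $ k else 0)"
    unfolding \<phi>_def by (intro sum.cong) (auto simp: axis_def)
  ultimately obtain v where v: "\<phi> v \<noteq> 0"
    by (intro that[of "axis j 1"]) simp
  \<comment> \<open>\<open>w\<close> is fixed by \<open>g\<close>, so comparing the pairing of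
    \<open>v\<close> and \<open>w\<close> before and after applying \<open>g\<close> leaves only the
    term \<open>\<phi> v * herm u w\<close>.\<close>
  have orth: "herm u w = 0" if "\<phi> w = 0" for w
  proof -
    have "herm (g *v v) (g *v w) = herm v w"
      using assms(1) by (simp add: unitary_def)
    then show ?thesis
      using that v by (simp add: g herm_diff herm_scale)
  qed
  have \<phi>u: "\<phi> u \<noteq> 0"
    using orth[of u] u by auto
  have \<phi>_eq: "\<phi> w = \<phi> u * herm w u / herm u u" for w
  proof -
    have "\<phi> (w - (\<phi> w / \<phi> u) *s u) = 0"
      using \<phi>u by (simp add: \<phi>)
    then have "herm (w - (\<phi> w / \<phi> u) *s u) u = 0"
      using orth herm_eq_0_commute by blast
    then show ?thesis
      using \<phi>u u by (simp add: herm_diff herm_scale field_simps)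
  qed
  \<comment> \<open>The eigenvalue is read off from
    \<open>g *v u = u - \<phi> u *s u\<close>.\<close>
  have "refl_with u (1 - \<phi> u) g"
    unfolding refl_with_def
  proof
    fix w
    show "g *v w = w + ((1 - \<phi> u - 1) * herm w u / herm u u) *s u"
      using g[of w] \<phi>_eq[of w] by simp
  qed
  with u \<phi>u show ?thesis
    by (intro that) auto
qed

section \<open>Finite unitary groups and their reflection subgroups\<close>

text \<open>Multiplication by an element \<open>z\<close> permutes \<open>Z\<close>, and comparing
  the products over \<open>Z\<close> gives \<open>z ^ card Z = 1\<close>. There are only
  \<open>card Z\<close> such roots, so all of them occur.\<close>

lemma finite_mult_closed_eq_roots_unity:
  fixes Z :: "complex set"
  assumes "finite Z" "Z \<noteq> {}" "0 \<notin> Z" "\<And>x y. x \<in> Z \<Longrightarrow> y \<in> Z \<Longrightarrow> x * y \<in> Z"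
  shows "Z = {z. z ^ card Z = 1}"
proof -
  have "z ^ card Z = 1" if z: "z \<in> Z" for z
  proof -
    have "inj_on ((*) z) Z"
      using z assms(3) by (auto simp: inj_on_def)
    moreover have "(*) z ` Z \<subseteq> Z"
      using z assms(4) by auto
    ultimately have "bij_betw ((*) z) Z Z"
      using endo_inj_surj[OF assms(1)] by (auto simp: bij_betw_def)
    then have "(\<Prod>w\<in>Z. z * w) = \<Prod>Z"
      using prod.reindex_bij_betw[of "(*) z" Z Z "\<lambda>w. w"] by simp
    then have "z ^ card Z * \<Prod>Z = \<Prod>Z"
      by (simp add: prod.distrib)
    moreover have "\<Prod>Z \<noteq> 0"
      using assms(1,3) by (simp add: prod_zero_iff)
    ultimately show ?thesis
      by simp
  qed
  moreover have "card Z > 0"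
    using assms(1,2) by (simp add: card_gt_0_iff)
  ultimately show ?thesis
    by (intro card_subset_eq) (auto simp: finite_roots_unity card_roots_unity_eq)
qed

lemma roots_unity_subset_iff:
  assumes "m > 0" "n > 0"
  shows "{z :: complex. z ^ m = 1} \<subseteq> {z. z ^ n = 1} \<longleftrightarrow> m dvd n"
proof
  assume "m dvd n"
  then show "{z :: complex. z ^ m = 1} \<subseteq> {z. z ^ n = 1}"
    by (auto simp: dvd_def power_mult)
next
  assume *: "{z :: complex. z ^ m = 1} \<subseteq> {z. z ^ n = 1}"
  \<comment> \<open>A primitive \<open>m\<close>-th root of unity detects divisibility by
    \<open>m\<close>.\<close>
  define z where "z = exp (2 * of_real pi * \<i> * of_nat 1 / of_nat m)"
  have "z ^ m = 1"
    unfolding z_def using assms by (intro complex_root_unity) simp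
  then have "z ^ n = 1"
    using * by auto
  then have "exp (2 * of_real pi * \<i> * of_nat n / of_nat m) = 1"
    by (simp add: z_def exp_of_nat_mult[symmetric] mult_ac)
  then show "m dvd n"
    using assms complex_root_unity_eq_1[of m n] by simp
qed

text \<open>The Rayleigh quotient at \<open>a\<close>. It is defined for every matrix, equals 1 at
  the identity if \<open>a\<close> is nonzero, and extracts the parameter of
  \<open>refl_with\<close> without a choice operator.\<close>

definition eigenval :: "complex^'d \<Rightarrow> complex^'d^'d \<Rightarrow> complex" where
  "eigenval a g = herm (g *v a) a / herm a a"

lemma eigenval_eq: "refl_with a z g \<Longrightarrow> a \<noteq> 0 \<Longrightarrow> eigenval a g = z"
  by (simp add: eigenval_def refl_with_root herm_scale)

text \<open>Used for \<open>G\<close> and again for its normal reflection subgroups, whose own roots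
  and components are studied in the primitive case.\<close>

locale unitary_group =
  fixes G :: "(complex^'d^'d) set"
  assumes subgroup: "subgroup G GL"
    and finite_group: "finite G"
    and unitary: "g \<in> G \<Longrightarrow> unitary g"
begin

lemmas group_D = subgroup_GL_D[OF subgroup]

lemma herm_invariant: "g \<in> G \<Longrightarrow> herm (g *v v) (g *v w) = herm v w"
  using unitary by (auto simp: unitary_def)

text \<open>Trades rank and root line for the explicit formula, in which the identity is the case
  \<open>z = 1\<close> and closure under products and inverses is visible.\<close>

lemma refl_subgroup_eq:
  assumes "a \<noteq> 0"
  shows "refl_subgroup G a = {g\<in>G. \<exists>z. refl_with a z g}"
proof (intro equalityI subsetI)
  fix g assume "g \<in> refl_subgroup G a"
  then consider "g = mat 1" | "g \<in> G" "reflection g" "root_line g = vec.span {a}"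
    by (auto simp: refl_subgroup_def)
  then show "g \<in> {g\<in>G. \<exists>z. refl_with a z g}"
  proof cases
    case 1
    then show ?thesis
      using refl_with_one group_D(2) by blast
  next
    case 2
    obtain b z where b: "b \<noteq> 0" "z \<noteq> 1" "refl_with b z g"
      using reflection_refl_with[OF unitary[OF 2(1)] 2(2)] .
    then have "vec.span {a} = vec.span {b}"
      using refl_with_reflection(2)[OF b(3,1,2) group_D(1)[OF 2(1)]] 2(3) by simp
    then show ?thesis
      using refl_with_span[OF b(3)] assms 2(1) by blast
  qed
next
  fix g assume "g \<in> {g\<in>G. \<exists>z. refl_with a z g}"
  then obtain z where z: "g \<in> G" "refl_with a z g"
    by auto
  then show "g \<in> refl_subgroup G a"
    using refl_with_reflection[OF z(2) assms _ group_D(1)] refl_with_one[of a g]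
    by (cases "z = 1") (auto simp: refl_subgroup_def)
qed

lemma group_roots_iff: "b \<in> group_roots G \<longleftrightarrow> b \<noteq> 0 \<and> (\<exists>g\<in>G. \<exists>z. z \<noteq> 1 \<and> refl_with b z g)"
proof (intro iffI conjI)
  assume "b \<in> group_roots G"
  then obtain g where g: "b \<noteq> 0" "g \<in> G" "reflection g" "b \<in> root_line g"
    by (auto simp: group_roots_def)
  obtain c z where c: "c \<noteq> 0" "z \<noteq> 1" "refl_with c z g"
    using reflection_refl_with[OF unitary[OF g(2)] g(3)] .
  then have "b \<in> vec.span {c}"
    using refl_with_reflection(2)[OF c(3,1,2) group_D(1)[OF g(2)]] g(4) by simp
  then have "refl_with b z g"
    using refl_with_span[OF c(3)] span_singleton_eqI g(1) by blast
  then show "\<exists>g\<in>G. \<exists>z. z \<noteq> 1 \<and> refl_with b z g"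
    using g(2) c(2) by blast
next
  assume "b \<noteq> 0 \<and> (\<exists>g\<in>G. \<exists>z. z \<noteq> 1 \<and> refl_with b z g)"
  then obtain g z where g: "b \<noteq> 0" "g \<in> G" "z \<noteq> 1" "refl_with b z g"
    by auto
  then show "b \<in> group_roots G"
    using refl_with_reflection[OF g(4,1,3) group_D(1)[OF g(2)]]
    by (auto simp: group_roots_def vec.span_base)
qed (auto simp: group_roots_def)

section \<open>The groups \<open>R_a\<close> inside the complex roots of unity\<close>

lemma refl_subgroup_refl_with:
  assumes "a \<noteq> 0" "g \<in> refl_subgroup G a"
  shows "g \<in> G" "refl_with a (eigenval a g) g"
  using assms by (auto simp: refl_subgroup_eq eigenval_eq)

lemma subgroup_refl_subgroup:
  assumes "a \<noteq> 0"
  shows "subgroup (refl_subgroup G a) GL"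
  unfolding subgroup_GL_iff refl_subgroup_eq[OF assms]
proof (intro conjI ballI)
  show "mat 1 \<in> {g\<in>G. \<exists>z. refl_with a z g}"
    using group_D(2) refl_with_one by blast
  fix x assume "x \<in> {g\<in>G. \<exists>z. refl_with a z g}"
  then obtain z where x: "x \<in> G" "refl_with a z x"
    by blast
  show "invertible x"
    using group_D(1)[OF x(1)] .
  show "inv\<^bsub>GL\<^esub> x \<in> {g\<in>G. \<exists>z. refl_with a z g}"
    using group_D(4)[OF x(1)] refl_with_inv[OF x(2) assms group_D(1)[OF x(1)]] by blast
  fix y assume "y \<in> {g\<in>G. \<exists>z. refl_with a z g}"
  then show "x ** y \<in> {g\<in>G. \<exists>z. refl_with a z g}"
    using group_D(3)[OF x(1)] refl_with_mult[OF x(2) _ assms] by blast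
qed

lemma eigenval_mult:
  assumes "a \<noteq> 0" "g \<in> refl_subgroup G a" "h \<in> refl_subgroup G a"
  shows "eigenval a (g ** h) = eigenval a g * eigenval a h"
  using assms by (intro eigenval_eq refl_with_mult refl_subgroup_refl_with(2))

lemma inj_on_eigenval:
  assumes "a \<noteq> 0"
  shows "inj_on (eigenval a) (refl_subgroup G a)"
proof (rule inj_onI)
  fix g h assume "g \<in> refl_subgroup G a" "h \<in> refl_subgroup G a" "eigenval a g = eigenval a h"
  then show "g = h"
    using refl_with_unique refl_subgroup_refl_with(2)[OF assms] by metis
qed

lemma finite_refl_subgroup: "a \<noteq> 0 \<Longrightarrow> finite (refl_subgroup G a)"
  using finite_group by (simp add: refl_subgroup_eq)

text \<open>The eigenvalue is an injective homomorphism on \<open>R_a\<close>, so the image of a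
  subgroup is a finite multiplicative set of nonzero numbers, hence a full group of roots of unity.
  This takes the place of cyclicity of \<open>R_a\<close>.\<close>

lemma eigenval_image:
  assumes "a \<noteq> 0" "subgroup H GL" "H \<subseteq> refl_subgroup G a"
  shows "eigenval a ` H = {z. z ^ card H = 1}"
proof -
  have fin: "finite H"
    using finite_subset[OF assms(3) finite_refl_subgroup[OF assms(1)]] .
  have "eigenval a g \<noteq> 0" if "g \<in> H" for g
    using that assms(3) refl_subgroup_refl_with[OF assms(1)] refl_with_nonzero[OF _ assms(1)] group_D(1)
    by blast
  moreover have "eigenval a g * eigenval a h \<in> eigenval a ` H" if "g \<in> H" "h \<in> H" for g h
    using that assms eigenval_mult[OF assms(1), of g h] subgroup_GL_D(3)[OF assms(2)]
    by (metis imageI subsetD)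
  ultimately have "eigenval a ` H = {z. z ^ card (eigenval a ` H) = 1}"
    using fin subgroup_GL_D(2)[OF assms(2)] by (intro finite_mult_closed_eq_roots_unity) auto
  also have "card (eigenval a ` H) = card H"
    using inj_on_subset[OF inj_on_eigenval[OF assms(1)] assms(3)] by (rule card_image)
  finally show ?thesis .
qed

text \<open>A subgroup is recovered from its order alone; this is the uniqueness behind
  \<open>refl_subgroup_of_order\<close>.\<close>

lemma subgroup_eq_eigenval:
  assumes "a \<noteq> 0" "subgroup H GL" "H \<subseteq> refl_subgroup G a"
  shows "H = {g \<in> refl_subgroup G a. eigenval a g ^ card H = 1}"
proof (intro equalityI subsetI)
  fix g assume "g \<in> H"
  then show "g \<in> {g \<in> refl_subgroup G a. eigenval a g ^ card H = 1}"
    using eigenval_image[OF assms] assms(3) by auto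
next
  fix g assume g: "g \<in> {g \<in> refl_subgroup G a. eigenval a g ^ card H = 1}"
  then have "eigenval a g \<in> eigenval a ` H"
    using eigenval_image[OF assms] by simp
  then show "g \<in> H"
    using inj_on_image_mem_iff[OF inj_on_eigenval[OF assms(1)]] g assms(3) by blast
qed

lemma card_refl_subgroup_pos: "a \<noteq> 0 \<Longrightarrow> card (refl_subgroup G a) > 0"
  using subgroup_GL_D(2)[OF subgroup_refl_subgroup] finite_refl_subgroup
  by (auto simp: card_gt_0_iff)

lemma eigenval_subgroup:
  assumes "a \<noteq> 0"
  shows "subgroup {g \<in> refl_subgroup G a. eigenval a g ^ n = 1} GL"
  unfolding subgroup_GL_iff
proof (intro conjI ballI)
  note R = subgroup_GL_D[OF subgroup_refl_subgroup[OF assms]]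
  show "mat 1 \<in> {g \<in> refl_subgroup G a. eigenval a g ^ n = 1}"
    using R(2) assms by (simp add: eigenval_def)
  fix x assume x: "x \<in> {g \<in> refl_subgroup G a. eigenval a g ^ n = 1}"
  then show "invertible x"
    using R(1) by simp
  have "refl_with a (1 / eigenval a x) (inv\<^bsub>GL\<^esub> x)"
    using x R(1) assms by (intro refl_with_inv refl_subgroup_refl_with(2)) auto
  then have "eigenval a (inv\<^bsub>GL\<^esub> x) = 1 / eigenval a x"
    using assms by (rule eigenval_eq)
  then show "inv\<^bsub>GL\<^esub> x \<in> {g \<in> refl_subgroup G a. eigenval a g ^ n = 1}"
    using x R(4) by (simp add: power_divide)
  fix y assume "y \<in> {g \<in> refl_subgroup G a. eigenval a g ^ n = 1}"
  then show "x ** y \<in> {g \<in> refl_subgroup G a. eigenval a g ^ n = 1}"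
    using x R(3) eigenval_mult[OF assms] by (simp add: power_mult_distrib)
qed

text \<open>As \<open>n\<close> divides the order of \<open>R_a\<close>, every \<open>n\<close>-th
  root of unity is available as an eigenvalue.\<close>

lemma eigenval_image_dvd:
  assumes "a \<noteq> 0" "n dvd card (refl_subgroup G a)"
  shows "eigenval a ` {g \<in> refl_subgroup G a. eigenval a g ^ n = 1} = {z. z ^ n = 1}"
proof -
  have "n > 0"
    using assms card_refl_subgroup_pos[OF assms(1)] by (auto intro: Nat.gr0I)
  then have "{z. z ^ n = 1} \<subseteq> eigenval a ` refl_subgroup G a"
    using eigenval_image[OF assms(1) subgroup_refl_subgroup[OF assms(1)]] assms
      roots_unity_subset_iff[OF _ card_refl_subgroup_pos[OF assms(1)], of n] by simp
  then show ?thesis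
    by auto
qed

lemma card_eigenval_subgroup:
  assumes "a \<noteq> 0" "n dvd card (refl_subgroup G a)"
  shows "card {g \<in> refl_subgroup G a. eigenval a g ^ n = 1} = n"
proof -
  have "n > 0"
    using assms card_refl_subgroup_pos[OF assms(1)] by (auto intro: Nat.gr0I)
  have "card {g \<in> refl_subgroup G a. eigenval a g ^ n = 1}
      = card (eigenval a ` {g \<in> refl_subgroup G a. eigenval a g ^ n = 1})"
    using inj_on_subset[OF inj_on_eigenval[OF assms(1)]] by (subst card_image) auto
  also have "\<dots> = n"
    using \<open>n > 0\<close> by (simp add: eigenval_image_dvd[OF assms] card_roots_unity_eq)
  finally show ?thesis .
qed

lemma refl_subgroup_of_order_eq:
  assumes "a \<noteq> 0" "n dvd card (refl_subgroup G a)"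
  shows "refl_subgroup_of_order G a n = {g \<in> refl_subgroup G a. eigenval a g ^ n = 1}"
  unfolding refl_subgroup_of_order_def
proof (rule the_equality)
  note R = subgroup_refl_subgroup[OF assms(1)]
  show "subgroup {g \<in> refl_subgroup G a. eigenval a g ^ n = 1} (GL\<lparr>carrier := refl_subgroup G a\<rparr>) \<and>
      card {g \<in> refl_subgroup G a. eigenval a g ^ n = 1} = n"
    using GL.subgroup_incl[OF eigenval_subgroup[OF assms(1)] R] card_eigenval_subgroup[OF assms]
    by blast
  fix H assume H: "subgroup H (GL\<lparr>carrier := refl_subgroup G a\<rparr>) \<and> card H = n"
  then have "subgroup H GL" "H \<subseteq> refl_subgroup G a"
    using GL.incl_subgroup[OF R] subgroup.subset by fastforce+
  then show "H = {g \<in> refl_subgroup G a. eigenval a g ^ n = 1}"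
    using subgroup_eq_eigenval[OF assms(1), of H] H by simp
qed

lemma conjugate_refl_subgroup:
  assumes "g \<in> G" "a \<noteq> 0"
  shows "conjugate g (refl_subgroup G a) = refl_subgroup G (g *v a)"
proof -
  have *: "conjugate x (refl_subgroup G b) \<subseteq> refl_subgroup G (x *v b)" if "x \<in> G" "b \<noteq> 0" for x b
  proof -
    have "x *v b \<noteq> 0"
      using invertible_vector_mult_eq_0[OF group_D(1)[OF that(1)]] that(2) by simp
    then show ?thesis
      unfolding conjugate_eq using that
      by (auto simp: refl_subgroup_eq intro!: group_D exI refl_with_conjugate unitary)
  qed
  have nz: "g *v a \<noteq> 0" and inv: "invertible g"
    using invertible_vector_mult_eq_0 group_D(1)[OF assms(1)] assms(2) by auto
  have "conjugate (inv\<^bsub>GL\<^esub> g) (refl_subgroup G (g *v a)) \<subseteq> refl_subgroup G a"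
    using *[OF group_D(4)[OF assms(1)] nz] inv by (simp add: GL_inv_vector_mult)
  then have "conjugate g (conjugate (inv\<^bsub>GL\<^esub> g) (refl_subgroup G (g *v a))) \<subseteq> conjugate g (refl_subgroup G a)"
    by (auto simp: conjugate_eq)
  also have "conjugate g (conjugate (inv\<^bsub>GL\<^esub> g) (refl_subgroup G (g *v a))) = refl_subgroup G (g *v a)"
    using inv conjugate_inv_cancel(1)[OF inv]
    by (simp add: conjugate_eq image_image)
  finally show ?thesis
    using *[OF assms] by blast
qed

end

section \<open>The linear characters attached to orbits of root lines\<close>

text \<open>The coefficient of \<open>v\<close> in terms of \<open>u\<close> when \<open>v\<close>
  lies on the line of \<open>u\<close>, written as an orthogonal projection so that it is defined
  for all pairs.\<close>

definition line_coef :: "complex^'d \<Rightarrow> complex^'d \<Rightarrow> complex" where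
  "line_coef u v = herm v u / herm u u"

lemma line_coef: "v \<in> vec.span {u} \<Longrightarrow> v = line_coef u v *s u"
  by (cases "u = 0") (auto simp: line_coef_def mem_span_singleton herm_scale)

lemma line_coef_scale: "s \<noteq> 0 \<Longrightarrow> line_coef (s *s u) (t *s v) = t / s * line_coef u v"
  by (simp add: line_coef_def herm_scale)

locale line_system =
  fixes \<L> :: "(complex^'d) set set"
  assumes finite_lines: "finite \<L>"
    and line: "L \<in> \<L> \<Longrightarrow> \<exists>u. u \<noteq> 0 \<and> L = vec.span {u}"
begin

definition choice :: "((complex^'d) set \<Rightarrow> complex^'d) \<Rightarrow> bool" where
  "choice b \<longleftrightarrow> (\<forall>L\<in>\<L>. b L \<in> L \<and> b L \<noteq> 0)"

definition preserves :: "complex^'d^'d \<Rightarrow> bool" where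
  "preserves x \<longleftrightarrow> invertible x \<and> (\<forall>L\<in>\<L>. (*v) x ` L \<in> \<L>)"

text \<open>The product of the nonzero entries of the monomial matrix by which \<open>x\<close> permutes the chosen
  vectors \<open>b L\<close> up to scalars.\<close>

definition transfer :: "((complex^'d) set \<Rightarrow> complex^'d) \<Rightarrow> complex^'d^'d \<Rightarrow> complex" where
  "transfer b x = (\<Prod>L\<in>\<L>. line_coef (b ((*v) x ` L)) (x *v b L))"

lemma choice_span: "choice b \<Longrightarrow> L \<in> \<L> \<Longrightarrow> L = vec.span {b L}"
  using line[of L] span_singleton_eqI by (auto simp: choice_def)

lemma preserves_bij:
  assumes "preserves x"
  shows "bij_betw ((`) ((*v) x)) \<L> \<L>"
proof -
  have "inj_on ((`) ((*v) x)) \<L>"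
    using inj_image_eq_iff[OF invertible_vector_mult_inj[of x]] assms
    by (auto simp: preserves_def intro: inj_onI)
  moreover have "(`) ((*v) x) ` \<L> \<subseteq> \<L>"
    using assms by (auto simp: preserves_def)
  ultimately show ?thesis
    using endo_inj_surj[OF finite_lines] by (auto simp: bij_betw_def)
qed

lemma choice_coef:
  assumes "choice b" "preserves x" "L \<in> \<L>"
  shows "x *v b L = line_coef (b ((*v) x ` L)) (x *v b L) *s b ((*v) x ` L)"
proof -
  have "x *v b L \<in> (*v) x ` L"
    using assms by (auto simp: choice_def)
  also have "\<dots> = vec.span {b ((*v) x ` L)}"
    using choice_span[OF assms(1)] assms(2,3) by (auto simp: preserves_def)
  finally show ?thesis
    by (rule line_coef)
qed

text \<open>The coefficient of \<open>x ** y\<close> at \<open>L\<close> is that of \<open>y\<close>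
  at \<open>L\<close> times that of \<open>x\<close> at the image of \<open>L\<close> under
  \<open>y\<close>; reindexing by the permutation that \<open>y\<close> induces on the lines
  separates the two products.\<close>

lemma transfer_mult:
  assumes "choice b" "preserves x" "preserves y"
  shows "transfer b (x ** y) = transfer b x * transfer b y"
proof -
  have "line_coef (b ((*v) (x ** y) ` L)) ((x ** y) *v b L) =
      line_coef (b ((*v) x ` (*v) y ` L)) (x *v b ((*v) y ` L)) * line_coef (b ((*v) y ` L)) (y *v b L)"
    if L: "L \<in> \<L>" for L
  proof -
    let ?c = "line_coef (b ((*v) y ` L)) (y *v b L)"
    have "(x ** y) *v b L = x *v (y *v b L)"
      by (simp add: matrix_vector_mul_assoc)
    also have "\<dots> = x *v (?c *s b ((*v) y ` L))"
      using choice_coef[OF assms(1,3) L] by simp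
    also have "\<dots> = ?c *s (x *v b ((*v) y ` L))"
      by (rule vector_mult_scale)
    finally have "(x ** y) *v b L = ?c *s (x *v b ((*v) y ` L))" .
    moreover have "(*v) (x ** y) ` L = (*v) x ` (*v) y ` L"
      by (simp add: image_image matrix_vector_mul_assoc)
    ultimately show ?thesis
      by (simp add: line_coef_def herm_scale mult_ac)
  qed
  then show ?thesis
    using prod.reindex_bij_betw[OF preserves_bij[OF assms(3)], of "\<lambda>L. line_coef (b ((*v) x ` L)) (x *v b L)"]
    by (simp add: transfer_def prod.distrib)
qed

lemma transfer_one: "choice b \<Longrightarrow> transfer b (mat 1) = 1"
  by (simp add: transfer_def line_coef_def choice_def)

text \<open>Rescaling the chosen vectors by \<open>t\<close> multiplies the factor at
  \<open>L\<close> by \<open>t L\<close> over the value of \<open>t\<close> at the image of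
  \<open>L\<close>; these ratios cancel in the product since \<open>x\<close> permutes the
  lines.\<close>

lemma transfer_choice_independent:
  assumes "choice b" "choice c" "preserves x"
  shows "transfer b x = transfer c x"
proof -
  define t where "t L = line_coef (b L) (c L)" for L
  have t: "c L = t L *s b L" "t L \<noteq> 0" if "L \<in> \<L>" for L
  proof -
    show "c L = t L *s b L"
      unfolding t_def using assms(2) that choice_span[OF assms(1) that]
      by (intro line_coef) (auto simp: choice_def)
    then show "t L \<noteq> 0"
      using assms(2) that by (auto simp: choice_def)
  qed
  have "line_coef (c ((*v) x ` L)) (x *v c L) = t L / t ((*v) x ` L) * line_coef (b ((*v) x ` L)) (x *v b L)"
    if "L \<in> \<L>" for L
    using that t[of L] t[of "(*v) x ` L"] assms(3)
    by (simp add: preserves_def vector_mult_scale line_coef_scale)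
  then have "transfer c x = (\<Prod>L\<in>\<L>. t L) / (\<Prod>L\<in>\<L>. t ((*v) x ` L)) * transfer b x"
    by (simp add: transfer_def prod.distrib prod_dividef)
  also have "(\<Prod>L\<in>\<L>. t ((*v) x ` L)) = (\<Prod>L\<in>\<L>. t L)"
    using prod.reindex_bij_betw[OF preserves_bij[OF assms(3)]] by simp
  finally show ?thesis
    using t(2) finite_lines by (simp add: prod_zero_iff)
qed

text \<open>The projection \<open>P\<close> along \<open>a\<close> onto the fixed hyperplane of the reflection \<open>s\<close> satisfies
  \<open>P \<circ> s = P\<close>.  Choosing the vector of every other line \<open>L\<close> such that its projection depends only on
  \<open>P ` L\<close> makes the choice \<open>s\<close>-equivariant, so only the root line contributes to the product.\<close>

lemma transfer_refl_with:
  assumes "choice b" "preserves s" "refl_with a z s" "a \<noteq> 0"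
  shows "transfer b s = (if vec.span {a} \<in> \<L> then z else 1)"
proof -
  define P where "P u = u - (herm u a / herm a a) *s a" for u
  have Ps: "P (s *v u) = P u" for u
    using assms(4) by (simp add: P_def refl_withD[OF assms(3)] herm_add herm_scale
        add_divide_distrib vec.scale_left_distrib)
  have P_scale: "P (t *s u) = t *s P u" for t u
    by (simp add: P_def herm_scale vec.scale_right_diff_distrib)
  have P_0: "u \<in> vec.span {a}" if "P u = 0" for u
    using that by (auto simp: P_def mem_span_singleton)
  define rep where "rep W = (SOME w :: complex^'d. w \<in> W \<and> w \<noteq> 0)" for W
  define c where "c L = (if L = vec.span {a} then a else SOME u. u \<in> L \<and> P u = rep (P ` L))" for L
  \<comment> \<open>The kernel of \<open>P\<close> is the line of \<open>a\<close>, so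
    \<open>P\<close> is injective on every other line, and a vector there is determined by its
    projection.\<close>
  have line_P: "u \<in> vec.span {a} \<Longrightarrow> u = 0" if "L \<in> \<L>" "L \<noteq> vec.span {a}" "u \<in> L" for u L
    using that line[OF that(1)] span_singleton_eqI by metis
  have c: "c L \<in> L \<and> P (c L) = rep (P ` L) \<and> rep (P ` L) \<noteq> 0"
    if L: "L \<in> \<L>" "L \<noteq> vec.span {a}" for L
  proof -
    obtain u where u: "u \<noteq> 0" "u \<in> L"
      using line[OF L(1)] vec.span_base by auto
    have "P u \<noteq> 0"
      using P_0 line_P[OF L u(2)] u(1) by blast
    then have "\<exists>w. w \<in> P ` L \<and> w \<noteq> 0"
      using u(2) by blast
    then have rep: "rep (P ` L) \<in> P ` L" "rep (P ` L) \<noteq> 0"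
      unfolding rep_def by (metis (mono_tags, lifting) someI_ex)+
    then have "\<exists>u. u \<in> L \<and> P u = rep (P ` L)"
      by (metis imageE)
    then show ?thesis
      using someI_ex[of "\<lambda>u. u \<in> L \<and> P u = rep (P ` L)"] L(2) rep(2) by (simp add: c_def)
  qed
  have choice: "choice c"
    unfolding choice_def
  proof
    fix L assume L: "L \<in> \<L>"
    have "P 0 = 0"
      by (simp add: P_def)
    then show "c L \<in> L \<and> c L \<noteq> 0"
      using c[OF L] assms(4) by (cases "L = vec.span {a}") (auto simp: c_def vec.span_base)
  qed
  have sa: "s *v a = z *s a"
    using refl_with_root[OF assms(3,4)] .
  have z: "z \<noteq> 0"
    using assms refl_with_nonzero by (auto simp: preserves_def)
  have s_span: "(*v) s ` vec.span {a} = vec.span {a}"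
    using z by (simp add: vector_mult_span_image sa span_singleton_eqI mem_span_singleton assms(4))
  have factor: "line_coef (c ((*v) s ` L)) (s *v c L) = 1" if L: "L \<in> \<L>" "L \<noteq> vec.span {a}" for L
  proof -
    let ?L = "(*v) s ` L"
    have sL: "?L \<in> \<L>"
      using L assms(2) by (simp add: preserves_def)
    have "?L \<noteq> vec.span {a}"
      using L(2) s_span assms(2) invertible_vector_mult_inj[of s]
      by (metis inj_image_eq_iff preserves_def)
    note c' = c[OF sL this]
    have "P ` ?L = P ` L"
      by (simp add: image_image Ps)
    then have P_eq: "P (s *v c L) = P (c ?L)"
      using c[OF L] c' Ps by simp
    have coef: "s *v c L = line_coef (c ?L) (s *v c L) *s c ?L"
      using choice_coef[OF choice assms(2) L(1)] .
    then have "P (c ?L) = line_coef (c ?L) (s *v c L) *s P (c ?L)"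
      using P_eq P_scale by metis
    then show ?thesis
      using c' by (metis vec.scale_cancel_right vec.scale_one)
  qed
  have "transfer b s = transfer c s"
    using assms(1,2) choice by (intro transfer_choice_independent)
  also have "\<dots> = (\<Prod>L\<in>\<L>. if L = vec.span {a} then z else 1)"
    unfolding transfer_def
  proof (intro prod.cong refl)
    fix L assume "L \<in> \<L>"
    then show "line_coef (c ((*v) s ` L)) (s *v c L) = (if L = vec.span {a} then z else 1)"
      using factor s_span sa assms(4) by (auto simp: c_def line_coef_def herm_scale)
  qed
  also have "\<dots> = (if vec.span {a} \<in> \<L> then z else 1)"
    using finite_lines by simp
  finally show ?thesis .
qed

end

section \<open>Normal reflection subgroups\<close>

text \<open>The subgroups of the groups \<open>R_a\<close> and their conjugates contain the
  identity, which is not a reflection, while a generating set in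
  \<open>generated_by_reflections\<close> has to consist of reflections.\<close>

lemma generate_remove_one:
  assumes "S \<subseteq> carrier GL"
  shows "generate GL S = generate GL (S - {mat 1})"
proof
  have "S \<subseteq> generate GL (S - {mat 1})"
    using generate.one[of GL "S - {mat 1}"] by (auto intro: generate.incl)
  then show "generate GL S \<subseteq> generate GL (S - {mat 1})"
    using assms by (intro GL.generate_subgroup_incl GL.generate_is_subgroup) auto
qed (intro GL.mono_generate, auto)

lemma reflections_subset_carrier: "S \<subseteq> {g. reflection g} \<Longrightarrow> S \<subseteq> carrier GL"
  by (auto simp: reflection_def)

lemma generated_by_reflections_subgroup: "generated_by_reflections H \<Longrightarrow> subgroup H GL"
  by (auto simp: generated_by_reflections_def intro!: GL.generate_is_subgroup dest: reflections_subset_carrier)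

text \<open>Replaces an unspecified generating set by the canonical one, all reflections in
  \<open>H\<close>, which behaves well under inclusion and conjugation.\<close>

lemma generated_by_reflections_iff:
  "generated_by_reflections H \<longleftrightarrow> subgroup H GL \<and> H \<subseteq> generate GL {g\<in>H. reflection g}"
proof (intro iffI conjI)
  assume H: "generated_by_reflections H"
  then obtain S where S: "S \<subseteq> {g. reflection g}" "H = generate GL S"
    by (auto simp: generated_by_reflections_def)
  then have "S \<subseteq> {g\<in>H. reflection g}"
    by (auto intro: generate.incl)
  then show "H \<subseteq> generate GL {g\<in>H. reflection g}"
    unfolding S(2) by (rule GL.mono_generate)
next
  assume H: "subgroup H GL \<and> H \<subseteq> generate GL {g\<in>H. reflection g}"
  then have "generate GL {g\<in>H. reflection g} \<subseteq> H"
    by (intro GL.generate_subgroup_incl) auto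
  with H show "generated_by_reflections H"
    by (auto simp: generated_by_reflections_def intro!: exI[of _ "{g\<in>H. reflection g}"])
qed (rule generated_by_reflections_subgroup)

context unitary_group
begin

lemma normal_iff:
  "N \<lhd> GL\<lparr>carrier := G\<rparr> \<longleftrightarrow>
     subgroup N GL \<and> N \<subseteq> G \<and> (\<forall>g\<in>G. \<forall>n\<in>N. g ** n ** inv\<^bsub>GL\<^esub> g \<in> N)"
proof -
  interpret sub: group "GL\<lparr>carrier := G\<rparr>"
    by (rule GL.subgroup_imp_group[OF subgroup])
  have "subgroup N (GL\<lparr>carrier := G\<rparr>) \<longleftrightarrow> subgroup N GL \<and> N \<subseteq> G"
    using GL.incl_subgroup[OF subgroup] GL.subgroup_incl[OF _ subgroup] subgroup.subset by fastforce
  moreover have "inv\<^bsub>GL\<lparr>carrier := G\<rparr>\<^esub> g = inv\<^bsub>GL\<^esub> g" if "g \<in> G" for g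
    using GL.m_inv_consistent[OF subgroup that] .
  ultimately show ?thesis
    by (auto simp: sub.normal_inv_iff)
qed

lemma nrs_iff:
  "N \<in> normal_reflection_subgroups G \<longleftrightarrow>
     subgroup N GL \<and> N \<subseteq> G \<and> (\<forall>g\<in>G. \<forall>n\<in>N. g ** n ** inv\<^bsub>GL\<^esub> g \<in> N) \<and>
     N \<subseteq> generate GL {g\<in>N. reflection g}"
  by (auto simp: normal_reflection_subgroups_def normal_iff generated_by_reflections_iff)

lemma nrs_D:
  assumes "N \<in> normal_reflection_subgroups G"
  shows "subgroup N GL" "N \<subseteq> G" "g \<in> G \<Longrightarrow> n \<in> N \<Longrightarrow> g ** n ** inv\<^bsub>GL\<^esub> g \<in> N"
    "generate GL {g\<in>N. reflection g} = N"
proof -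
  show N: "subgroup N GL" "N \<subseteq> G" "g \<in> G \<Longrightarrow> n \<in> N \<Longrightarrow> g ** n ** inv\<^bsub>GL\<^esub> g \<in> N"
    using assms by (auto simp: nrs_iff)
  have "generate GL {g\<in>N. reflection g} \<subseteq> N"
    using N(1) by (intro GL.generate_subgroup_incl) auto
  then show "generate GL {g\<in>N. reflection g} = N"
    using assms by (auto simp: nrs_iff)
qed

lemma conjugate_reflection:
  assumes "g \<in> G" "s \<in> G" "reflection s"
  shows "reflection (g ** s ** inv\<^bsub>GL\<^esub> g)"
proof -
  obtain b z where b: "b \<noteq> 0" "z \<noteq> 1" "refl_with b z s"
    using reflection_refl_with[OF unitary[OF assms(2)] assms(3)] .
  have "g *v b \<noteq> 0"
    using invertible_vector_mult_eq_0[OF group_D(1)[OF assms(1)]] b(1) by simp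
  then show ?thesis
    using refl_with_conjugate[OF b(3) unitary[OF assms(1)]] b(2)
      group_D(1)[OF group_D(3)[OF group_D(3)[OF assms(1,2)] group_D(4)[OF assms(1)]]]
    by (intro refl_with_reflection(1))
qed

lemma nrs_generate:
  assumes "S \<subseteq> G" "S \<subseteq> {s. reflection s}"
    and "\<And>g s. g \<in> G \<Longrightarrow> s \<in> S \<Longrightarrow> g ** s ** inv\<^bsub>GL\<^esub> g \<in> S"
  shows "generate GL S \<in> normal_reflection_subgroups G"
proof -
  interpret sub: group "GL\<lparr>carrier := G\<rparr>"
    by (rule GL.subgroup_imp_group[OF subgroup])
  have "inv\<^bsub>GL\<lparr>carrier := G\<rparr>\<^esub> g = inv\<^bsub>GL\<^esub> g" if "g \<in> G" for g
    using GL.m_inv_consistent[OF subgroup that] .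
  then have "generate (GL\<lparr>carrier := G\<rparr>) S \<lhd> GL\<lparr>carrier := G\<rparr>"
    using assms(1,3) by (intro sub.normal_generateI) auto
  then have "generate GL S \<lhd> GL\<lparr>carrier := G\<rparr>"
    using GL.generate_consistent[OF assms(1) subgroup] by simp
  then show ?thesis
    using assms(2) by (auto simp: normal_reflection_subgroups_def generated_by_reflections_def)
qed

text \<open>An intersection of reflection subgroups need not be generated by reflections, so the
  meet keeps only the reflections in common. A normal reflection subgroup below both is generated by
  its reflections, and these are among the generators of the meet.\<close>

lemma nrs_meet_glb:
  assumes "M \<in> normal_reflection_subgroups G" "N \<in> normal_reflection_subgroups G"
  shows "nrs_meet M N \<in> normal_reflection_subgroups G" "nrs_meet M N \<subseteq> M" "nrs_meet M N \<subseteq> N"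
    "L \<in> normal_reflection_subgroups G \<Longrightarrow> L \<subseteq> M \<Longrightarrow> L \<subseteq> N \<Longrightarrow> L \<subseteq> nrs_meet M N"
proof -
  note M = nrs_D[OF assms(1)] and N = nrs_D[OF assms(2)]
  show "nrs_meet M N \<in> normal_reflection_subgroups G"
    unfolding nrs_meet_def using M(2,3) N(3) by (intro nrs_generate) (auto intro: conjugate_reflection)
  show "nrs_meet M N \<subseteq> M"
    unfolding nrs_meet_def using M(1) by (intro GL.generate_subgroup_incl) auto
  show "nrs_meet M N \<subseteq> N"
    unfolding nrs_meet_def using N(1) by (intro GL.generate_subgroup_incl) auto
  assume L: "L \<in> normal_reflection_subgroups G" "L \<subseteq> M" "L \<subseteq> N"
  have "generate GL {g\<in>L. reflection g} \<subseteq> nrs_meet M N"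
    unfolding nrs_meet_def using L(2,3) by (intro GL.mono_generate) auto
  then show "L \<subseteq> nrs_meet M N"
    using nrs_D(4)[OF L(1)] by simp
qed

text \<open>Minimality is stated against arbitrary subgroups \<open>L\<close> of \<open>GL\<close>,
  so that it applies to the product set before that is known to be a reflection subgroup.\<close>

lemma nrs_join_lub:
  assumes "M \<in> normal_reflection_subgroups G" "N \<in> normal_reflection_subgroups G"
  shows "nrs_join M N \<in> normal_reflection_subgroups G" "M \<subseteq> nrs_join M N" "N \<subseteq> nrs_join M N"
    "subgroup L GL \<Longrightarrow> M \<subseteq> L \<Longrightarrow> N \<subseteq> L \<Longrightarrow> nrs_join M N \<subseteq> L"
proof -
  note M = nrs_D[OF assms(1)] and N = nrs_D[OF assms(2)]
  \<comment> \<open>The union of the two groups is not a set of reflections, but its reflections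
    generate each of the groups and hence the join.\<close>
  let ?S = "{g \<in> M \<union> N. reflection g}"
  have S: "generate GL ?S \<in> normal_reflection_subgroups G"
    using M(2,3) N(2,3) by (intro nrs_generate) (auto intro: conjugate_reflection)
  show le: "M \<subseteq> nrs_join M N" "N \<subseteq> nrs_join M N"
    by (auto simp: nrs_join_def intro: generate.incl)
  have "M \<subseteq> generate GL ?S" "N \<subseteq> generate GL ?S"
    using M(4) N(4) GL.mono_generate[of "{g\<in>M. reflection g}" ?S]
      GL.mono_generate[of "{g\<in>N. reflection g}" ?S] by auto
  then have "nrs_join M N \<subseteq> generate GL ?S"
    unfolding nrs_join_def using nrs_D(1)[OF S] by (intro GL.generate_subgroup_incl) auto
  moreover have "generate GL ?S \<subseteq> nrs_join M N"
    unfolding nrs_join_def by (intro GL.mono_generate) auto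
  ultimately have "nrs_join M N = generate GL ?S"
    by (rule subset_antisym)
  with S show "nrs_join M N \<in> normal_reflection_subgroups G"
    by simp
  assume "subgroup L GL" "M \<subseteq> L" "N \<subseteq> L"
  then show "nrs_join M N \<subseteq> L"
    unfolding nrs_join_def by (intro GL.generate_subgroup_incl) auto
qed

lemma nrs_join_eq_set_mult:
  assumes "M \<in> normal_reflection_subgroups G" "N \<in> normal_reflection_subgroups G"
  shows "nrs_join M N = M <#>\<^bsub>GL\<^esub> N"
proof
  note M = nrs_D[OF assms(1)] and N = nrs_D[OF assms(2)]
  note SM = subgroup_GL_D[OF M(1)] and SN = subgroup_GL_D[OF N(1)]
  have mem: "x \<in> M <#>\<^bsub>GL\<^esub> N \<longleftrightarrow> (\<exists>g\<in>M. \<exists>h\<in>N. x = g ** h)" for x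
    by (auto simp: set_mult_def)
  have "subgroup (M <#>\<^bsub>GL\<^esub> N) GL"
    unfolding subgroup_GL_iff
  proof (intro conjI ballI)
    show "mat 1 \<in> M <#>\<^bsub>GL\<^esub> N"
      unfolding mem using SM(2) SN(2) by (metis matrix_mul_lid)
    fix x assume "x \<in> M <#>\<^bsub>GL\<^esub> N"
    then obtain g h where x: "g \<in> M" "h \<in> N" "x = g ** h"
      by (auto simp: mem)
    have inv: "invertible g" "invertible h"
      using x SM(1) SN(1) by auto
    then show "invertible x"
      by (simp add: x(3) invertible_mult)
    let ?h = "inv\<^bsub>GL\<^esub> h"
    \<comment> \<open>Normality moves the factor from \<open>M\<close> to the left: the inverse of
      \<open>g ** h\<close> is the inverse of \<open>g\<close>, conjugated by \<open>?h\<close>,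
      followed by \<open>?h\<close>.\<close>
    have "?h ** inv\<^bsub>GL\<^esub> g ** inv\<^bsub>GL\<^esub> ?h \<in> M"
      using x SM(4) SN(4) N(2) by (intro M(3)) auto
    moreover have "inv\<^bsub>GL\<^esub> x = (?h ** inv\<^bsub>GL\<^esub> g ** inv\<^bsub>GL\<^esub> ?h) ** ?h"
      using inv GL.inv_mult_group[of g h]
      by (simp add: x(3) matrix_mul_assoc[symmetric] GL_inv_matrix_mult)
    ultimately show "inv\<^bsub>GL\<^esub> x \<in> M <#>\<^bsub>GL\<^esub> N"
      unfolding mem using x(2) SN(4) by blast
    fix y assume "y \<in> M <#>\<^bsub>GL\<^esub> N"
    then obtain g' h' where y: "g' \<in> M" "h' \<in> N" "y = g' ** h'"
      by (auto simp: mem)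
    have "g ** (h ** g' ** ?h) \<in> M"
      using x y N(2) by (intro SM(3) M(3)) auto
    moreover have "x ** y = (g ** (h ** g' ** ?h)) ** (h ** h')"
    proof -
      have "?h ** (h ** h') = h'"
        using inv(2) by (simp add: matrix_mul_assoc GL_inv_matrix_mult)
      then show ?thesis
        by (simp add: x(3) y(3) matrix_mul_assoc[symmetric])
    qed
    ultimately show "x ** y \<in> M <#>\<^bsub>GL\<^esub> N"
      unfolding mem using SN(3)[OF x(2) y(2)] by blast
  qed
  moreover have "M \<subseteq> M <#>\<^bsub>GL\<^esub> N" "N \<subseteq> M <#>\<^bsub>GL\<^esub> N"
    using SM(2) SN(2) matrix_mul_lid matrix_mul_rid by (force simp: mem)+
  ultimately show "nrs_join M N \<subseteq> M <#>\<^bsub>GL\<^esub> N"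
    by (rule nrs_join_lub(4)[OF assms])
  have "subgroup (nrs_join M N) GL"
    using nrs_D(1)[OF nrs_join_lub(1)[OF assms]] .
  then show "M <#>\<^bsub>GL\<^esub> N \<subseteq> nrs_join M N"
    using nrs_join_lub(2,3)[OF assms] subgroup_GL_D(3) by (fastforce simp: mem)
qed

section \<open>Conjugation orbits and their linear characters\<close>

lemma group_conjugate: "g \<in> G \<Longrightarrow> x \<in> G \<Longrightarrow> g ** x ** inv\<^bsub>GL\<^esub> g \<in> G"
  using group_D(3,4) by simp

lemma conj_orbit_conjugate:
  assumes "g \<in> G" "H \<subseteq> G"
  shows "conj_orbit G (conjugate g H) = conj_orbit G H"
proof -
  have conj: "conjugate x (conjugate g H) = conjugate (x ** g) H" if "x \<in> G" for x
    using that assms group_D(1) by (intro conjugate_conjugate) auto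
  have "conjugate x H \<in> conj_orbit G (conjugate g H)" if x: "x \<in> G" for x
  proof -
    have "x ** inv\<^bsub>GL\<^esub> g \<in> G" "x ** inv\<^bsub>GL\<^esub> g ** g = x"
      using group_D x assms(1) by (simp_all add: matrix_mul_assoc[symmetric] GL_inv_matrix_mult)
    then show ?thesis
      using conj[of "x ** inv\<^bsub>GL\<^esub> g"] by (auto simp: conj_orbit_def)
  qed
  moreover have "conjugate x (conjugate g H) \<in> conj_orbit G H" if "x \<in> G" for x
    using conj[OF that] group_D(3)[OF that assms(1)] by (auto simp: conj_orbit_def)
  ultimately show ?thesis
    by (auto simp: conj_orbit_def)
qed

lemma refl_subgroup_subset: "refl_subgroup G a \<subseteq> G"
  using group_D(2) by (auto simp: refl_subgroup_def)

lemma conjugate_one: "conjugate (mat 1) H = H"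
  by (simp add: conjugate_eq GL.inv_one[unfolded GL_simps])

text \<open>\<open>G\<close> permutes the finitely many lines in the orbit of the line of
  \<open>a\<close>, so \<open>transfer\<close> restricts to a linear character. Multiplicativity and
  the values on reflections are all that is used afterwards; the existential form hides the chosen
  vectors.\<close>

lemma orbit_character:
  assumes "a \<noteq> 0"
  obtains ch :: "complex^'d^'d \<Rightarrow> complex"
  where "\<And>x y. x \<in> G \<Longrightarrow> y \<in> G \<Longrightarrow> ch (x ** y) = ch x * ch y" "ch (mat 1) = 1"
    "\<And>b z s. s \<in> G \<Longrightarrow> b \<noteq> 0 \<Longrightarrow> refl_with b z s \<Longrightarrow>
       ch s = (if \<exists>g\<in>G. vec.span {b} = vec.span {g *v a} then z else 1)"
proof -
  define \<L> where "\<L> = (\<lambda>g. vec.span {g *v a}) ` G"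
  interpret line_system \<L>
  proof
    show "finite \<L>"
      using finite_group by (simp add: \<L>_def)
    fix L assume "L \<in> \<L>"
    then show "\<exists>u. u \<noteq> 0 \<and> L = vec.span {u}"
      using assms invertible_vector_mult_eq_0 group_D(1) by (auto simp: \<L>_def)
  qed
  have pres: "preserves x" if "x \<in> G" for x
    unfolding preserves_def using that group_D(1,3)
    by (auto simp: \<L>_def vector_mult_span_image matrix_vector_mul_assoc)
  have "\<exists>b. choice b"
    using line vec.span_base unfolding choice_def by (intro bchoice) blast
  then obtain b where b: "choice b" ..
  show ?thesis
  proof (rule that)
    show "transfer b (x ** y) = transfer b x * transfer b y" if "x \<in> G" "y \<in> G" for x y
      using transfer_mult[OF b] pres that by blast
    show "transfer b (mat 1) = 1"
      using transfer_one[OF b] .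
    show "transfer b s = (if \<exists>g\<in>G. vec.span {c} = vec.span {g *v a} then z else 1)"
      if "s \<in> G" "c \<noteq> 0" "refl_with c z s" for c z s
      using transfer_refl_with[OF b pres[OF that(1)] that(3,2)] by (auto simp: \<L>_def)
  qed
qed

end

section \<open>The lattice of divisors\<close>

text \<open>Explicit bounds \<open>j\<close> and \<open>i\<close> give the lattice, and antisymmetry
  identifies them with its join and meet. This serves both the divisor tuples and the normal
  reflection subgroups.\<close>

lemma lattice_of_bounds:
  assumes eq: "eq L = (=)"
    and le_refl: "\<And>x. x \<in> carrier L \<Longrightarrow> x \<sqsubseteq>\<^bsub>L\<^esub> x"
    and le_antisym': "\<And>x y. x \<in> carrier L \<Longrightarrow> y \<in> carrier L \<Longrightarrow> x \<sqsubseteq>\<^bsub>L\<^esub> y \<Longrightarrow> y \<sqsubseteq>\<^bsub>L\<^esub> x \<Longrightarrow> x = y"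
    and le_trans': "\<And>x y z. x \<in> carrier L \<Longrightarrow> y \<in> carrier L \<Longrightarrow> z \<in> carrier L \<Longrightarrow>
      x \<sqsubseteq>\<^bsub>L\<^esub> y \<Longrightarrow> y \<sqsubseteq>\<^bsub>L\<^esub> z \<Longrightarrow> x \<sqsubseteq>\<^bsub>L\<^esub> z"
    and join: "\<And>x y. x \<in> carrier L \<Longrightarrow> y \<in> carrier L \<Longrightarrow>
      j x y \<in> carrier L \<and> x \<sqsubseteq>\<^bsub>L\<^esub> j x y \<and> y \<sqsubseteq>\<^bsub>L\<^esub> j x y \<and>
      (\<forall>z\<in>carrier L. x \<sqsubseteq>\<^bsub>L\<^esub> z \<longrightarrow> y \<sqsubseteq>\<^bsub>L\<^esub> z \<longrightarrow> j x y \<sqsubseteq>\<^bsub>L\<^esub> z)"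
    and meet: "\<And>x y. x \<in> carrier L \<Longrightarrow> y \<in> carrier L \<Longrightarrow>
      i x y \<in> carrier L \<and> i x y \<sqsubseteq>\<^bsub>L\<^esub> x \<and> i x y \<sqsubseteq>\<^bsub>L\<^esub> y \<and>
      (\<forall>z\<in>carrier L. z \<sqsubseteq>\<^bsub>L\<^esub> x \<longrightarrow> z \<sqsubseteq>\<^bsub>L\<^esub> y \<longrightarrow> z \<sqsubseteq>\<^bsub>L\<^esub> i x y)"
  shows "lattice L \<and> (\<forall>x\<in>carrier L. \<forall>y\<in>carrier L. x \<sqinter>\<^bsub>L\<^esub> y = i x y \<and> x \<squnion>\<^bsub>L\<^esub> y = j x y)"
proof (intro conjI ballI)
  interpret partial_order L
  proof
    fix x y z
    show "x \<in> carrier L \<Longrightarrow> x .=\<^bsub>L\<^esub> x"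
      by (simp add: eq)
    show "x .=\<^bsub>L\<^esub> y \<Longrightarrow> x \<in> carrier L \<Longrightarrow> y \<in> carrier L \<Longrightarrow> y .=\<^bsub>L\<^esub> x"
      by (simp add: eq)
    show "x .=\<^bsub>L\<^esub> y \<Longrightarrow> y .=\<^bsub>L\<^esub> z \<Longrightarrow> x \<in> carrier L \<Longrightarrow> y \<in> carrier L \<Longrightarrow> z \<in> carrier L \<Longrightarrow> x .=\<^bsub>L\<^esub> z"
      by (simp add: eq)
    show "x \<in> carrier L \<Longrightarrow> x \<sqsubseteq>\<^bsub>L\<^esub> x"
      by (rule le_refl)
    show "x \<sqsubseteq>\<^bsub>L\<^esub> y \<Longrightarrow> y \<sqsubseteq>\<^bsub>L\<^esub> x \<Longrightarrow> x \<in> carrier L \<Longrightarrow> y \<in> carrier L \<Longrightarrow> x .=\<^bsub>L\<^esub> y"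
      using le_antisym' by (simp add: eq)
    show "x \<sqsubseteq>\<^bsub>L\<^esub> y \<Longrightarrow> y \<sqsubseteq>\<^bsub>L\<^esub> z \<Longrightarrow> x \<in> carrier L \<Longrightarrow> y \<in> carrier L \<Longrightarrow> z \<in> carrier L \<Longrightarrow> x \<sqsubseteq>\<^bsub>L\<^esub> z"
      by (rule le_trans')
    show "x .=\<^bsub>L\<^esub> y \<Longrightarrow> z .=\<^bsub>L\<^esub> w \<Longrightarrow> x \<in> carrier L \<Longrightarrow> y \<in> carrier L \<Longrightarrow> z \<in> carrier L \<Longrightarrow> w \<in> carrier L \<Longrightarrow>
        x \<sqsubseteq>\<^bsub>L\<^esub> z \<longleftrightarrow> y \<sqsubseteq>\<^bsub>L\<^esub> w" for w
      by (simp add: eq)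
    show "eq L = (=)"
      by (rule eq)
  qed
  have least: "least L (j x y) (Upper L {x, y})" if "x \<in> carrier L" "y \<in> carrier L" for x y
    using join[OF that] that by (auto simp: least_def Upper_def)
  have greatest: "greatest L (i x y) (Lower L {x, y})" if "x \<in> carrier L" "y \<in> carrier L" for x y
    using meet[OF that] that by (auto simp: greatest_def Lower_def)
  show L: "lattice L"
  proof
    show "\<exists>s. least L s (Upper L {x, y})" if "x \<in> carrier L" "y \<in> carrier L" for x y
      using least[OF that] by blast
    show "\<exists>s. greatest L s (Lower L {x, y})" if "x \<in> carrier L" "y \<in> carrier L" for x y
      using greatest[OF that] by blast
  qed
  then interpret lattice L .
  fix x y assume xy: "x \<in> carrier L" "y \<in> carrier L"
  show "x \<squnion>\<^bsub>L\<^esub> y = j x y"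
  proof (rule le_antisym')
    show "x \<squnion>\<^bsub>L\<^esub> y \<sqsubseteq>\<^bsub>L\<^esub> j x y"
      using join[OF xy] xy by (intro join_le) auto
    show "j x y \<sqsubseteq>\<^bsub>L\<^esub> x \<squnion>\<^bsub>L\<^esub> y"
      using join[OF xy] join_left[OF xy] join_right[OF xy] join_closed[OF xy] by blast
  qed (use join[OF xy] join_closed[OF xy] in auto)
  show "x \<sqinter>\<^bsub>L\<^esub> y = i x y"
  proof (rule le_antisym')
    show "i x y \<sqsubseteq>\<^bsub>L\<^esub> x \<sqinter>\<^bsub>L\<^esub> y"
      using meet[OF xy] xy by (intro meet_le) auto
    show "x \<sqinter>\<^bsub>L\<^esub> y \<sqsubseteq>\<^bsub>L\<^esub> i x y"
      using meet[OF xy] meet_left[OF xy] meet_right[OF xy] meet_closed[OF xy] by blast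
  qed (use meet[OF xy] meet_closed[OF xy] in auto)
qed

lemma divisor_tuples_D:
  assumes "\<alpha> \<in> divisor_tuples m k" "j \<in> {1..m}"
  shows "0 < \<alpha> j" "\<alpha> j dvd k j"
  using assms by (auto simp: divisor_tuples_def PiE_iff)

lemma divisor_tuples_eqI:
  assumes "\<alpha> \<in> divisor_tuples m k" "\<beta> \<in> divisor_tuples m k" "\<And>j. j \<in> {1..m} \<Longrightarrow> \<alpha> j = \<beta> j"
  shows "\<alpha> = \<beta>"
  using assms unfolding divisor_tuples_def by (rule PiE_ext)

lemma gcd_tuple_closed:
  "\<alpha> \<in> divisor_tuples m k \<Longrightarrow> \<beta> \<in> divisor_tuples m k \<Longrightarrow> gcd_tuple m \<alpha> \<beta> \<in> divisor_tuples m k"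
  by (auto simp: divisor_tuples_def gcd_tuple_def PiE_iff dvd_trans[OF gcd_dvd1])

lemma lcm_tuple_closed:
  "\<alpha> \<in> divisor_tuples m k \<Longrightarrow> \<beta> \<in> divisor_tuples m k \<Longrightarrow> lcm_tuple m \<alpha> \<beta> \<in> divisor_tuples m k"
  by (auto simp: divisor_tuples_def lcm_tuple_def PiE_iff lcm_pos_nat)

lemma lattice_divisor_order: "lattice (divisor_order m k)"
proof (rule lattice_of_bounds[where j = "lcm_tuple m" and i = "gcd_tuple m", THEN conjunct1])
  show "\<alpha> = \<beta>" if "\<alpha> \<in> carrier (divisor_order m k)" "\<beta> \<in> carrier (divisor_order m k)"
    "\<alpha> \<sqsubseteq>\<^bsub>divisor_order m k\<^esub> \<beta>" "\<beta> \<sqsubseteq>\<^bsub>divisor_order m k\<^esub> \<alpha>" for \<alpha> \<beta>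
  proof (rule divisor_tuples_eqI)
    show "\<alpha> j = \<beta> j" if "j \<in> {1..m}" for j
      using that \<open>\<alpha> \<sqsubseteq>\<^bsub>divisor_order m k\<^esub> \<beta>\<close> \<open>\<beta> \<sqsubseteq>\<^bsub>divisor_order m k\<^esub> \<alpha>\<close>
      by (intro dvd_antisym) (auto simp: divisor_order_def)
  qed (use that in \<open>auto simp: divisor_order_def\<close>)
  show "\<alpha> \<sqsubseteq>\<^bsub>divisor_order m k\<^esub> \<gamma>"
    if "\<alpha> \<sqsubseteq>\<^bsub>divisor_order m k\<^esub> \<beta>" "\<beta> \<sqsubseteq>\<^bsub>divisor_order m k\<^esub> \<gamma>" for \<alpha> \<beta> \<gamma>
    using that dvd_trans by (simp add: divisor_order_def) blast
qed (simp_all add: divisor_order_def gcd_tuple_closed lcm_tuple_closed,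
  simp_all add: gcd_tuple_def lcm_tuple_def)

lemma (in unitary_group) lattice_nrs_order:
  "lattice (nrs_order G) \<and> (\<forall>M\<in>normal_reflection_subgroups G. \<forall>N\<in>normal_reflection_subgroups G.
     M \<sqinter>\<^bsub>nrs_order G\<^esub> N = nrs_meet M N \<and> M \<squnion>\<^bsub>nrs_order G\<^esub> N = nrs_join M N)"
proof -
  have carrier: "carrier (nrs_order G) = normal_reflection_subgroups G"
    by (simp add: nrs_order_def)
  have "lattice (nrs_order G) \<and> (\<forall>M\<in>carrier (nrs_order G). \<forall>N\<in>carrier (nrs_order G).
     M \<sqinter>\<^bsub>nrs_order G\<^esub> N = nrs_meet M N \<and> M \<squnion>\<^bsub>nrs_order G\<^esub> N = nrs_join M N)"
  proof (rule lattice_of_bounds[where j = nrs_join and i = nrs_meet])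
    show "M \<sqsubseteq>\<^bsub>nrs_order G\<^esub> L" if "M \<sqsubseteq>\<^bsub>nrs_order G\<^esub> N" "N \<sqsubseteq>\<^bsub>nrs_order G\<^esub> L" for M N L
      using that by (simp add: nrs_order_def)
  qed (simp_all add: nrs_order_def nrs_meet_glb nrs_join_lub nrs_D(1))
  then show ?thesis
    unfolding carrier .
qed

section \<open>The correspondence\<close>

text \<open>In \<open>orbits\<close>, surjectivity makes each reflection of \<open>G\<close>
  conjugate to one in some \<open>R_{a_j}\<close>, and injectivity keeps the root lines of different
  \<open>a j\<close> in different orbits.\<close>

locale reflection_orbits = unitary_group G
  for G :: "(complex^'d^'d) set" +
  fixes m :: nat and a :: "nat \<Rightarrow> complex^'d" and k :: "nat \<Rightarrow> nat"
  assumes roots: "j \<in> {1..m} \<Longrightarrow> a j \<in> group_roots G"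
    and orbits: "bij_betw (\<lambda>j. conj_orbit G (refl_subgroup G (a j))) {1..m}
           {conj_orbit G (refl_subgroup G b) | b. b \<in> group_roots G}"
    and orders: "j \<in> {1..m} \<Longrightarrow> k j = card (refl_subgroup G (a j))"
begin

lemma root_nonzero: "j \<in> {1..m} \<Longrightarrow> a j \<noteq> 0"
  using roots by (auto simp: group_roots_def)

lemma reflection_conjugate_root:
  assumes "s \<in> G" "reflection s"
  obtains j g t where "j \<in> {1..m}" "g \<in> G" "t \<in> refl_subgroup G (a j)" "s = g ** t ** inv\<^bsub>GL\<^esub> g"
proof -
  obtain b z where b: "b \<noteq> 0" "z \<noteq> 1" "refl_with b z s"
    using reflection_refl_with[OF unitary[OF assms(1)] assms(2)] .
  then have "b \<in> group_roots G"
    using assms(1) by (auto simp: group_roots_iff)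
  then have "conj_orbit G (refl_subgroup G b) \<in> (\<lambda>j. conj_orbit G (refl_subgroup G (a j))) ` {1..m}"
    using bij_betw_imp_surj_on[OF orbits] by auto
  then obtain j where j: "j \<in> {1..m}" "conj_orbit G (refl_subgroup G b) = conj_orbit G (refl_subgroup G (a j))"
    by auto
  have "refl_subgroup G b \<in> conj_orbit G (refl_subgroup G b)"
    unfolding conj_orbit_def using conjugate_one[of "refl_subgroup G b", symmetric] group_D(2) by blast
  then obtain g where g: "g \<in> G" "refl_subgroup G b = conjugate g (refl_subgroup G (a j))"
    unfolding j(2) by (auto simp: conj_orbit_def)
  have "s \<in> refl_subgroup G b"
    using assms(1) b by (auto simp: refl_subgroup_eq)
  then show ?thesis
    using that j(1) g by (auto simp: conjugate_eq)
qed

lemma orbit_index_unique: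
  assumes "i \<in> {1..m}" "j \<in> {1..m}" "g \<in> G" "vec.span {a i} = vec.span {g *v a j}"
  shows "i = j"
proof -
  have "refl_subgroup G (a i) = conjugate g (refl_subgroup G (a j))"
    using conjugate_refl_subgroup[OF assms(3) root_nonzero[OF assms(2)]] assms(4)
    by (simp add: refl_subgroup_def)
  then have "conj_orbit G (refl_subgroup G (a i)) = conj_orbit G (refl_subgroup G (a j))"
    using conj_orbit_conjugate[OF assms(3) refl_subgroup_subset] by simp
  then show ?thesis
    using bij_betw_imp_inj_on[OF orbits] assms(1,2) by (auto dest: inj_onD)
qed

text \<open>The explicit form of \<open>refl_subgroup_of_order G (a j) n\<close> when
  \<open>n\<close> divides \<open>k j\<close>; it is a definite set for every \<open>n\<close>, free
  of the definite description.\<close>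

definition order_part :: "nat \<Rightarrow> nat \<Rightarrow> (complex^'d^'d) set" where
  "order_part j n = {t \<in> refl_subgroup G (a j). eigenval (a j) t ^ n = 1}"

lemma normal_power_eq:
  assumes "\<alpha> \<in> divisor_tuples m k"
  shows "normal_power G m a \<alpha> = generate GL (\<Union>j\<in>{1..m}. \<Union>g\<in>G. conjugate g (order_part j (\<alpha> j)))"
proof -
  have "refl_subgroup_of_order G (a j) (\<alpha> j) = order_part j (\<alpha> j)" if "j \<in> {1..m}" for j
    using divisor_tuples_D(2)[OF assms that] root_nonzero[OF that] orders[OF that]
    by (simp add: refl_subgroup_of_order_eq order_part_def)
  then show ?thesis
    by (simp add: normal_power_def)
qed

lemma order_part_subset: "order_part j n \<subseteq> G"
  using refl_subgroup_subset by (auto simp: order_part_def)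

lemma generators_subset: "(\<Union>j\<in>{1..m}. \<Union>g\<in>G. conjugate g (order_part j (\<alpha> j))) \<subseteq> G"
  by (auto simp: conjugate_eq intro!: group_conjugate dest: subsetD[OF order_part_subset])

lemma normal_power_incl:
  assumes "\<alpha> \<in> divisor_tuples m k" "j \<in> {1..m}"
  shows "order_part j (\<alpha> j) \<subseteq> normal_power G m a \<alpha>"
  unfolding normal_power_eq[OF assms(1)] using assms(2) group_D(2)
  by (intro subsetI generate.incl, intro UN_I) (assumption+, simp add: conjugate_one)

text \<open>The elements of \<open>G\<close> at which the \<open>\<alpha> j\<close>-th power of the
  orbit character is 1 form a subgroup. It contains every generator of \<open>G^alpha\<close>, hence
  the whole group, and inside \<open>R_{a_j}\<close> membership in it is the eigenvalue condition
  that defines \<open>order_part\<close>.\<close>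

lemma normal_power_eigenval:
  assumes "\<alpha> \<in> divisor_tuples m k" "j \<in> {1..m}"
    and t: "t \<in> refl_subgroup G (a j)" "t \<in> normal_power G m a \<alpha>"
  shows "t \<in> order_part j (\<alpha> j)"
proof -
  obtain ch :: "complex^'d^'d \<Rightarrow> complex"
    where mult: "\<And>x y. x \<in> G \<Longrightarrow> y \<in> G \<Longrightarrow> ch (x ** y) = ch x * ch y" and one: "ch (mat 1) = 1"
    and refl: "\<And>b z s. s \<in> G \<Longrightarrow> b \<noteq> 0 \<Longrightarrow> refl_with b z s \<Longrightarrow>
       ch s = (if \<exists>g\<in>G. vec.span {b} = vec.span {g *v a j} then z else 1)"
    using orbit_character[OF root_nonzero[OF assms(2)]] by blast
  have inv: "ch x * ch (inv\<^bsub>GL\<^esub> x) = 1" if "x \<in> G" for x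
    using mult[OF that group_D(4)[OF that]] one GL_inv_matrix_mult(2)[OF group_D(1)[OF that]] by simp
  have "subgroup {x\<in>G. ch x ^ \<alpha> j = 1} GL"
    unfolding subgroup_GL_iff
  proof (intro conjI ballI)
    show "mat 1 \<in> {x\<in>G. ch x ^ \<alpha> j = 1}"
      using one group_D(2) by simp
    fix x assume x: "x \<in> {x\<in>G. ch x ^ \<alpha> j = 1}"
    then show "invertible x"
      using group_D(1) by simp
    have "ch x ^ \<alpha> j * ch (inv\<^bsub>GL\<^esub> x) ^ \<alpha> j = 1"
      using inv[of x] x by (metis (no_types, lifting) mem_Collect_eq power_mult_distrib power_one)
    then show "inv\<^bsub>GL\<^esub> x \<in> {x\<in>G. ch x ^ \<alpha> j = 1}"
      using x group_D(4) by simp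
    fix y assume "y \<in> {x\<in>G. ch x ^ \<alpha> j = 1}"
    then show "x ** y \<in> {x\<in>G. ch x ^ \<alpha> j = 1}"
      using x mult group_D(3) by (simp add: power_mult_distrib)
  qed
  moreover have "ch x ^ \<alpha> j = 1"
    if i: "i \<in> {1..m}" and g: "g \<in> G" and u: "u \<in> order_part i (\<alpha> i)" and x: "x = g ** u ** inv\<^bsub>GL\<^esub> g"
    for i g u x
  proof -
    have uG: "u \<in> G"
      using u order_part_subset by blast
    \<comment> \<open>A character does not see conjugation.\<close>
    have "ch x = ch u"
      using mult g uG group_D(3,4) inv[OF g] by (simp add: x mult_ac)
    also have "\<dots> = (if \<exists>g\<in>G. vec.span {a i} = vec.span {g *v a j} then eigenval (a i) u else 1)"
      using u refl_subgroup_refl_with[OF root_nonzero[OF i]] refl[OF uG root_nonzero[OF i]]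
      by (simp add: order_part_def)
    \<comment> \<open>If the line of \<open>a i\<close> lies in the orbit of that of
      \<open>a j\<close>, then \<open>i = j\<close> and the power is 1 by the choice of
      \<open>u\<close>; otherwise the value itself is 1.\<close>
    finally show ?thesis
      using u orbit_index_unique[OF i assms(2)] by (auto simp: order_part_def)
  qed
  ultimately have "normal_power G m a \<alpha> \<subseteq> {x\<in>G. ch x ^ \<alpha> j = 1}"
    unfolding normal_power_eq[OF assms(1)]
    by (intro GL.generate_subgroup_incl subsetI)
      (auto simp: conjugate_eq intro!: group_conjugate dest: subsetD[OF order_part_subset])
  then have "ch t ^ \<alpha> j = 1"
    using t(2) by auto
  moreover have "\<exists>g\<in>G. vec.span {a j} = vec.span {g *v a j}"
    using group_D(2) by (intro bexI[of _ "mat 1"]) auto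
  then have "ch t = eigenval (a j) t"
    using refl[OF _ root_nonzero[OF assms(2)]] refl_subgroup_refl_with[OF root_nonzero[OF assms(2)] t(1)]
    by simp
  ultimately show ?thesis
    using t(1) by (simp add: order_part_def)
qed

lemma normal_power_nrs:
  assumes "\<alpha> \<in> divisor_tuples m k"
  shows "normal_power G m a \<alpha> \<in> normal_reflection_subgroups G"
proof -
  let ?S = "\<Union>j\<in>{1..m}. \<Union>g\<in>G. conjugate g (order_part j (\<alpha> j))"
  have "generate GL (?S - {mat 1}) \<in> normal_reflection_subgroups G"
  proof (rule nrs_generate)
    show "?S - {mat 1} \<subseteq> G"
      using generators_subset by blast
    show "?S - {mat 1} \<subseteq> {s. reflection s}"
    proof
      fix s assume s: "s \<in> ?S - {mat 1}"
      then obtain j g t where t: "j \<in> {1..m}" "g \<in> G" "t \<in> order_part j (\<alpha> j)" "s = g ** t ** inv\<^bsub>GL\<^esub> g"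
        by (auto simp: conjugate_eq)
      have "t \<noteq> mat 1"
        using s t(4) GL_inv_matrix_mult(2)[OF group_D(1)[OF t(2)]] by auto
      then have "reflection t"
        using t(3) by (auto simp: order_part_def refl_subgroup_def)
      then show "s \<in> {s. reflection s}"
        using conjugate_reflection[OF t(2)] order_part_subset t(3,4) by blast
    qed
    fix g s assume g: "g \<in> G" and s: "s \<in> ?S - {mat 1}"
    then obtain j h where h: "j \<in> {1..m}" "h \<in> G" "s \<in> conjugate h (order_part j (\<alpha> j))"
      by auto
    then have "g ** s ** inv\<^bsub>GL\<^esub> g \<in> conjugate g (conjugate h (order_part j (\<alpha> j)))"
      by (simp add: conjugate_eq)
    also have "\<dots> = conjugate (g ** h) (order_part j (\<alpha> j))"
      using g h(2) group_D(1) order_part_subset by (intro conjugate_conjugate) auto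
    finally have "g ** s ** inv\<^bsub>GL\<^esub> g \<in> ?S"
      using h(1) group_D(3)[OF g h(2)] by blast
    moreover have "g ** s ** inv\<^bsub>GL\<^esub> g \<noteq> mat 1"
    proof
      assume *: "g ** s ** inv\<^bsub>GL\<^esub> g = mat 1"
      have "inv\<^bsub>GL\<^esub> g ** mat 1 ** g = s"
        using conjugate_inv_cancel(2)[OF group_D(1)[OF g], of s] unfolding * .
      then have "s = mat 1"
        using GL_inv_matrix_mult(1)[OF group_D(1)[OF g]] by simp
      then show False
        using s by simp
    qed
    ultimately show "g ** s ** inv\<^bsub>GL\<^esub> g \<in> ?S - {mat 1}"
      by simp
  qed
  moreover have "?S \<subseteq> carrier GL"
    using group_D(1) by (intro subset_trans[OF generators_subset]) auto
  ultimately show ?thesis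
    unfolding normal_power_eq[OF assms] by (simp add: generate_remove_one)
qed

lemma order_part_subset_iff:
  assumes "j \<in> {1..m}" "n > 0" "n' > 0" "n dvd k j" 
  shows "order_part j n \<subseteq> order_part j n' \<longleftrightarrow> n dvd n'"
proof
  assume "order_part j n \<subseteq> order_part j n'"
  then have "eigenval (a j) ` order_part j n \<subseteq> {z. z ^ n' = 1}"
    by (auto simp: order_part_def)
  then show "n dvd n'"
    using eigenval_image_dvd[OF root_nonzero[OF assms(1)], of n] assms orders[OF assms(1)]
    by (simp add: order_part_def roots_unity_subset_iff)
next
  assume "n dvd n'"
  then obtain r where "n' = n * r" ..
  then show "order_part j n \<subseteq> order_part j n'"
    by (auto simp: order_part_def power_mult)
qed

text \<open>Intersecting with \<open>R_{a_j}\<close> recovers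
  \<open>order_part j (\<alpha> j)\<close> from \<open>G^alpha\<close>, so an inclusion of groups is
  an inclusion of these parts for all \<open>j\<close>, that is, divisibility.\<close>

lemma normal_power_subset_iff:
  assumes "\<alpha> \<in> divisor_tuples m k" "\<beta> \<in> divisor_tuples m k"
  shows "normal_power G m a \<alpha> \<subseteq> normal_power G m a \<beta> \<longleftrightarrow> (\<forall>j\<in>{1..m}. \<alpha> j dvd \<beta> j)"
proof -
  have iff: "order_part j (\<alpha> j) \<subseteq> order_part j (\<beta> j) \<longleftrightarrow> \<alpha> j dvd \<beta> j" if j: "j \<in> {1..m}" for j
    using divisor_tuples_D[OF assms(1) j] divisor_tuples_D(1)[OF assms(2) j]
    by (intro order_part_subset_iff[OF j])
  show ?thesis
  proof
    assume sub: "normal_power G m a \<alpha> \<subseteq> normal_power G m a \<beta>"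
    show "\<forall>j\<in>{1..m}. \<alpha> j dvd \<beta> j"
    proof
      fix j assume j: "j \<in> {1..m}"
      have "order_part j (\<alpha> j) \<subseteq> order_part j (\<beta> j)"
        using normal_power_incl[OF assms(1) j] sub normal_power_eigenval[OF assms(2) j]
        by (auto simp: order_part_def)
      then show "\<alpha> j dvd \<beta> j"
        using iff[OF j] by simp
    qed
  next
    assume dvd: "\<forall>j\<in>{1..m}. \<alpha> j dvd \<beta> j"
    have "conjugate g (order_part j (\<alpha> j)) \<subseteq> conjugate g (order_part j (\<beta> j))" if "j \<in> {1..m}" for j g
      unfolding conjugate_eq using iff[OF that] dvd that by (intro image_mono) simp
    then show "normal_power G m a \<alpha> \<subseteq> normal_power G m a \<beta>"
      unfolding normal_power_eq[OF assms(1)] normal_power_eq[OF assms(2)]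
      by (intro GL.mono_generate UN_mono order_refl)
  qed
qed

lemma normal_power_surj:
  assumes "N \<in> normal_reflection_subgroups G"
  shows "\<exists>\<alpha>\<in>divisor_tuples m k. normal_power G m a \<alpha> = N"
proof
  note N = nrs_D[OF assms]
  \<comment> \<open>The only possible tuple, since \<open>G^alpha\<close> meets
    \<open>R_{a_j}\<close> in a subgroup of order \<open>\<alpha> j\<close>.\<close>
  define \<alpha> where "\<alpha> = (\<lambda>j\<in>{1..m}. card (N \<inter> refl_subgroup G (a j)))"
  have part: "order_part j (\<alpha> j) = N \<inter> refl_subgroup G (a j)" "\<alpha> j > 0" "\<alpha> j dvd k j"
    if j: "j \<in> {1..m}" for j
  proof -
    note nz = root_nonzero[OF j]
    have sub: "subgroup (N \<inter> refl_subgroup G (a j)) GL"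
      using GL.subgroups_Inter_pair[OF N(1) subgroup_refl_subgroup[OF nz]] .
    have \<alpha>: "\<alpha> j = card (N \<inter> refl_subgroup G (a j))"
      using j by (simp add: \<alpha>_def)
    show "order_part j (\<alpha> j) = N \<inter> refl_subgroup G (a j)"
      using subgroup_eq_eigenval[OF nz sub] by (simp add: order_part_def \<alpha>)
    show pos: "\<alpha> j > 0"
      using subgroup_GL_D(2)[OF sub] finite_refl_subgroup[OF nz] by (auto simp: \<alpha> card_gt_0_iff)
    have "{z :: complex. z ^ \<alpha> j = 1} \<subseteq> {z. z ^ k j = 1}"
      using image_mono[OF Int_lower2[of N "refl_subgroup G (a j)"], of "eigenval (a j)"]
      unfolding \<alpha> orders[OF j] eigenval_image[OF nz sub Int_lower2]
        eigenval_image[OF nz subgroup_refl_subgroup[OF nz] order_refl] by blast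
    then show "\<alpha> j dvd k j"
      using roots_unity_subset_iff[OF pos] card_refl_subgroup_pos[OF nz] by (simp add: orders[OF j])
  qed
  then show \<alpha>: "\<alpha> \<in> divisor_tuples m k"
    by (auto simp: divisor_tuples_def \<alpha>_def)
  show "normal_power G m a \<alpha> = N"
  proof
    show "normal_power G m a \<alpha> \<subseteq> N"
      unfolding normal_power_eq[OF \<alpha>] using N(1,3) part(1)
      by (intro GL.generate_subgroup_incl) (auto simp: conjugate_eq)
    have "{s\<in>N. reflection s} \<subseteq> (\<Union>j\<in>{1..m}. \<Union>g\<in>G. conjugate g (order_part j (\<alpha> j)))"
    proof
      fix s assume s: "s \<in> {s\<in>N. reflection s}"
      then obtain j g t where t: "j \<in> {1..m}" "g \<in> G" "t \<in> refl_subgroup G (a j)" "s = g ** t ** inv\<^bsub>GL\<^esub> g"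
        using reflection_conjugate_root N(2) by blast
      have inv: "invertible g"
        using group_D(1)[OF t(2)] .
      have "inv\<^bsub>GL\<^esub> g ** s ** inv\<^bsub>GL\<^esub> (inv\<^bsub>GL\<^esub> g) \<in> N"
        using s t(2) group_D(4) by (intro N(3)) auto
      \<comment> \<open>Undoing the conjugation by \<open>g\<close> stays in the normal subgroup
        \<open>N\<close>, so the representative \<open>t\<close> itself lies in
        \<open>N\<close>.\<close>
      then have "t \<in> N"
        using inv conjugate_inv_cancel(2)[OF inv] by (simp add: t(4))
      then have "t \<in> order_part j (\<alpha> j)"
        using t(3) part(1)[OF t(1)] by simp
      then have "s \<in> conjugate g (order_part j (\<alpha> j))"
        unfolding conjugate_eq t(4) by (rule imageI)
      then show "s \<in> (\<Union>j\<in>{1..m}. \<Union>g\<in>G. conjugate g (order_part j (\<alpha> j)))"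
        using t(1,2) by blast
    qed
    then have "generate GL {s\<in>N. reflection s} \<subseteq> normal_power G m a \<alpha>"
      unfolding normal_power_eq[OF \<alpha>] by (rule GL.mono_generate)
    then show "N \<subseteq> normal_power G m a \<alpha>"
      using N(4) by simp
  qed
qed

section \<open>Bijection, lattice operations and the count\<close>

lemma bij_betw_normal_power:
  "bij_betw (normal_power G m a) (divisor_tuples m k) (normal_reflection_subgroups G)"
proof (rule bij_betw_imageI)
  show "inj_on (normal_power G m a) (divisor_tuples m k)"
  proof (rule inj_onI)
    fix \<alpha> \<beta> assume *: "\<alpha> \<in> divisor_tuples m k" "\<beta> \<in> divisor_tuples m k"
      "normal_power G m a \<alpha> = normal_power G m a \<beta>"
    show "\<alpha> = \<beta>"
      using normal_power_subset_iff[OF *(1,2)] normal_power_subset_iff[OF *(2,1)] *(3)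
      by (intro divisor_tuples_eqI[OF *(1,2)] dvd_antisym) auto
  qed
  show "normal_power G m a ` divisor_tuples m k = normal_reflection_subgroups G"
    using normal_power_nrs normal_power_surj by blast
qed

lemma nrs_meet_normal_power:
  assumes "\<alpha> \<in> divisor_tuples m k" "\<beta> \<in> divisor_tuples m k"
  shows "nrs_meet (normal_power G m a \<alpha>) (normal_power G m a \<beta>) = normal_power G m a (gcd_tuple m \<alpha> \<beta>)"
proof
  note meet = nrs_meet_glb[OF normal_power_nrs[OF assms(1)] normal_power_nrs[OF assms(2)]]
  note closed = gcd_tuple_closed[OF assms]
  \<comment> \<open>By surjectivity the meet is itself some \<open>G^gamma\<close>; as it lies below
    both groups, \<open>\<gamma>\<close> divides both tuples and hence their gcd.\<close>
  obtain \<gamma> where \<gamma>: "\<gamma> \<in> divisor_tuples m k"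
    "normal_power G m a \<gamma> = nrs_meet (normal_power G m a \<alpha>) (normal_power G m a \<beta>)"
    using normal_power_surj[OF meet(1)] by blast
  then have "\<forall>j\<in>{1..m}. \<gamma> j dvd gcd_tuple m \<alpha> \<beta> j"
    using meet(2,3) normal_power_subset_iff[OF \<gamma>(1)] assms by (auto simp: gcd_tuple_def)
  then show "nrs_meet (normal_power G m a \<alpha>) (normal_power G m a \<beta>) \<subseteq> normal_power G m a (gcd_tuple m \<alpha> \<beta>)"
    using normal_power_subset_iff[OF \<gamma>(1) closed] \<gamma>(2) by simp
  show "normal_power G m a (gcd_tuple m \<alpha> \<beta>) \<subseteq> nrs_meet (normal_power G m a \<alpha>) (normal_power G m a \<beta>)"
    using normal_power_subset_iff[OF closed] assms
    by (intro meet(4) normal_power_nrs closed) (auto simp: gcd_tuple_def)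
qed

lemma nrs_join_normal_power:
  assumes "\<alpha> \<in> divisor_tuples m k" "\<beta> \<in> divisor_tuples m k"
  shows "nrs_join (normal_power G m a \<alpha>) (normal_power G m a \<beta>) = normal_power G m a (lcm_tuple m \<alpha> \<beta>)"
proof
  note join = nrs_join_lub[OF normal_power_nrs[OF assms(1)] normal_power_nrs[OF assms(2)]]
  note closed = lcm_tuple_closed[OF assms]
  obtain \<gamma> where \<gamma>: "\<gamma> \<in> divisor_tuples m k"
    "normal_power G m a \<gamma> = nrs_join (normal_power G m a \<alpha>) (normal_power G m a \<beta>)"
    using normal_power_surj[OF join(1)] by blast
  then have "\<forall>j\<in>{1..m}. lcm_tuple m \<alpha> \<beta> j dvd \<gamma> j"
    using join(2,3) normal_power_subset_iff[OF _ \<gamma>(1)] assms by (auto simp: lcm_tuple_def)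
  then show "normal_power G m a (lcm_tuple m \<alpha> \<beta>) \<subseteq> nrs_join (normal_power G m a \<alpha>) (normal_power G m a \<beta>)"
    using normal_power_subset_iff[OF closed \<gamma>(1)] \<gamma>(2) by simp
  show "nrs_join (normal_power G m a \<alpha>) (normal_power G m a \<beta>) \<subseteq> normal_power G m a (lcm_tuple m \<alpha> \<beta>)"
    using normal_power_subset_iff[OF _ closed] assms nrs_D(1)[OF normal_power_nrs[OF closed]]
    by (intro join(4)) (auto simp: lcm_tuple_def)
qed

lemma card_nrs: "card (normal_reflection_subgroups G) = (\<Prod>j\<in>{1..m}. sigma0 (k j))"
proof -
  have "card (normal_reflection_subgroups G) = card (divisor_tuples m k)"
    using bij_betw_same_card[OF bij_betw_normal_power] by simp
  also have "\<dots> = (\<Prod>j\<in>{1..m}. card {d. 0 < d \<and> d dvd k j})"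
    unfolding divisor_tuples_def by (intro card_PiE) simp
  also have "\<dots> = (\<Prod>j\<in>{1..m}. sigma0 (k j))"
  proof (intro prod.cong refl)
    fix j assume "j \<in> {1..m}"
    then have "k j > 0"
      using card_refl_subgroup_pos root_nonzero orders by simp
    then have "{d. 0 < d \<and> d dvd k j} = {d. d dvd k j}"
      by (auto intro: dvd_pos_nat)
    then show "card {d. 0 < d \<and> d dvd k j} = sigma0 (k j)"
      by (simp add: sigma0_def)
  qed
  finally show ?thesis .
qed

end

section \<open>Primitive groups\<close>

text \<open>The sums of families form a subspace containing every summand, so representations exist.
  Pairing the difference of two representations with one of its components leaves the squared norm
  of that component, so they are unique.\<close>

lemma direct_sum_of_orthogonal_subspaces:
  fixes \<V> :: "(complex^'d) set set"
  assumes fin: "finite \<V>" and subspace: "\<And>V. V \<in> \<V> \<Longrightarrow> vec.subspace V"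
    and orth: "\<And>V W x y. V \<in> \<V> \<Longrightarrow> W \<in> \<V> \<Longrightarrow> V \<noteq> W \<Longrightarrow> x \<in> V \<Longrightarrow> y \<in> W \<Longrightarrow> herm x y = 0"
    and span: "vec.span (\<Union>\<V>) = UNIV"
  shows "\<exists>!f. f \<in> (\<Pi>\<^sub>E V\<in>\<V>. V) \<and> v = (\<Sum>V\<in>\<V>. f V)"
proof (rule ex_ex1I)
  define U where "U = {v. \<exists>f\<in>\<Pi>\<^sub>E V\<in>\<V>. V. v = (\<Sum>V\<in>\<V>. f V)}"
  have UI: "(\<Sum>V\<in>\<V>. f V) \<in> U" if "\<And>V. V \<in> \<V> \<Longrightarrow> f V \<in> V" for f
    using that unfolding U_def by (intro CollectI bexI[of _ "restrict f \<V>"]) (auto intro: sum.cong)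
  have "vec.subspace U"
  proof (rule vec.subspaceI)
    show "0 \<in> U"
      using UI[of "\<lambda>_. 0"] vec.subspace_0[OF subspace] by simp
    fix x assume "x \<in> U"
    then obtain f where f: "f \<in> (\<Pi>\<^sub>E V\<in>\<V>. V)" "x = (\<Sum>V\<in>\<V>. f V)"
      by (auto simp: U_def)
    have f_mem: "f V \<in> V" if "V \<in> \<V>" for V
      using PiE_mem[OF f(1) that] .
    show "c *s x \<in> U" for c
      using UI[OF vec.subspace_scale[OF subspace f_mem]] by (simp add: f(2) vec.scale_sum_right)
    fix y assume "y \<in> U"
    then obtain g where g: "g \<in> (\<Pi>\<^sub>E V\<in>\<V>. V)" "y = (\<Sum>V\<in>\<V>. g V)"
      by (auto simp: U_def)
    have g_mem: "g V \<in> V" if "V \<in> \<V>" for V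
      using PiE_mem[OF g(1) that] .
    show "x + y \<in> U"
      using UI[OF vec.subspace_add[OF subspace f_mem g_mem]] by (simp add: f(2) g(2) sum.distrib)
  qed
  moreover have "\<Union>\<V> \<subseteq> U"
  proof
    fix x assume "x \<in> \<Union>\<V>"
    then obtain W where W: "x \<in> W" "W \<in> \<V>"
      by auto
    have "(\<Sum>V\<in>\<V>. if V = W then x else 0) \<in> U"
      using W subspace vec.subspace_0 by (intro UI) auto
    then show "x \<in> U"
      using W fin by simp
  qed
  ultimately have "vec.span (\<Union>\<V>) \<subseteq> U"
    by (intro vec.span_minimal)
  then show "\<exists>f. f \<in> (\<Pi>\<^sub>E V\<in>\<V>. V) \<and> v = (\<Sum>V\<in>\<V>. f V)"
    unfolding span U_def by blast
  fix f g assume f: "f \<in> (\<Pi>\<^sub>E V\<in>\<V>. V) \<and> v = (\<Sum>V\<in>\<V>. f V)"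
    and g: "g \<in> (\<Pi>\<^sub>E V\<in>\<V>. V) \<and> v = (\<Sum>V\<in>\<V>. g V)"
  show "f = g"
  proof (rule PiE_ext)
    show "f \<in> (\<Pi>\<^sub>E V\<in>\<V>. V)" "g \<in> (\<Pi>\<^sub>E V\<in>\<V>. V)"
      using f g by auto
    fix W assume W: "W \<in> \<V>"
    define d where "d V = f V - g V" for V
    have d: "d V \<in> V" if "V \<in> \<V>" for V
      using f g that subspace by (auto simp: d_def intro: vec.subspace_diff)
    have "0 = herm (\<Sum>V\<in>\<V>. d V) (d W)"
      using f g by (simp add: d_def sum_subtractf)
    also have "\<dots> = (\<Sum>V\<in>\<V>. if V = W then herm (d W) (d W) else 0)"
      unfolding herm_sum using orth d W by (intro sum.cong) auto
    also have "\<dots> = herm (d W) (d W)"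
      using fin W by simp
    finally have "d W = 0"
      by simp
    then show "f W = g W"
      by (simp add: d_def)
  qed
qed

section \<open>Components of the non-orthogonality graph on the roots\<close>

context unitary_group
begin

definition root_adj :: "((complex^'d) \<times> (complex^'d)) set" where
  "root_adj = {(b, c). b \<in> group_roots G \<and> c \<in> group_roots G \<and> herm b c \<noteq> 0}"

text \<open>Nonzero multiples of a root are roots, so the component of a root contains the nonzero
  vectors of its line; at a vector that is not a root it is just that vector.\<close>

definition root_component :: "complex^'d \<Rightarrow> (complex^'d) set" where
  "root_component b = root_adj\<^sup>* `` {b}"

lemma root_adj_sym: "sym root_adj"
  using herm_eq_0_commute by (auto simp: root_adj_def sym_def)

lemma root_component_self: "b \<in> root_component b"
  by (simp add: root_component_def)

lemma root_component_sym: "c \<in> root_component b \<Longrightarrow> b \<in> root_component c"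
  using symD[OF sym_rtrancl[OF root_adj_sym]] by (auto simp: root_component_def)

lemma root_component_eq:
  assumes "c \<in> root_component b"
  shows "root_component c = root_component b"
  using assms root_component_sym[OF assms] unfolding root_component_def
  by (intro equalityI subsetI) (blast intro: rtrancl_trans)+

lemma root_component_roots:
  assumes "b \<in> group_roots G" "c \<in> root_component b"
  shows "c \<in> group_roots G"
proof -
  have "(b, c) \<in> root_adj\<^sup>*"
    using assms(2) by (simp add: root_component_def)
  then show ?thesis
    using assms(1) by (induction rule: rtrancl_induct) (auto simp: root_adj_def)
qed

lemma root_component_step:
  assumes "b \<in> group_roots G" "c \<in> group_roots G" "herm b c \<noteq> 0"
  shows "c \<in> root_component b"
  using assms by (auto simp: root_component_def root_adj_def)

lemma root_component_orthogonal:
  assumes "b \<in> group_roots G" "c \<in> group_roots G" "c \<notin> root_component b"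
    and "x \<in> vec.span (root_component b)" "y \<in> vec.span (root_component c)"
  shows "herm x y = 0"
proof (rule span_herm_orthogonal[OF _ assms(4,5)])
  fix u v assume uv: "u \<in> root_component b" "v \<in> root_component c"
  show "herm u v = 0"
  proof (rule ccontr)
    assume "herm u v \<noteq> 0"
    then have "v \<in> root_component u"
      using uv root_component_roots assms(1,2) by (intro root_component_step) auto
    then have "root_component c = root_component b"
      using uv root_component_eq by metis
    then show False
      using assms(3) root_component_self by blast
  qed
qed

text \<open>A root line has infinitely many roots, but they share one component, which therefore
  depends only on a reflection with that root line; the finite group has finitely many of
  these.\<close>

lemma finite_root_components: "finite ((\<lambda>b. vec.span (root_component b)) ` group_roots G)"
proof (rule finite_subset)
  show "(\<lambda>b. vec.span (root_component b)) ` group_roots G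
      \<subseteq> (\<lambda>s. vec.span (\<Union>b\<in>root_line s - {0}. root_component b)) ` G"
  proof
    fix V assume "V \<in> (\<lambda>b. vec.span (root_component b)) ` group_roots G"
    then obtain b where b: "b \<in> group_roots G" "V = vec.span (root_component b)"
      by auto
    then obtain s z where s: "b \<noteq> 0" "s \<in> G" "z \<noteq> 1" "refl_with b z s"
      by (auto simp: group_roots_iff)
    note refl = refl_with_reflection[OF s(4,1,3) group_D(1)[OF s(2)]]
    have "root_component c = root_component b" if c: "c \<in> root_line s - {0}" for c
    proof (rule root_component_eq, rule root_component_step[OF b(1)])
      show "c \<in> group_roots G"
        using c refl(1) s(2) by (auto simp: group_roots_def)
      show "herm b c \<noteq> 0"
        using c s(1) by (auto simp: refl(2) mem_span_singleton herm_scale)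
    qed
    moreover have "b \<in> root_line s - {0}"
      using s(1) by (simp add: refl(2) vec.span_base)
    ultimately have "(\<Union>b\<in>root_line s - {0}. root_component b) = root_component b"
      by blast
    then show "V \<in> (\<lambda>s. vec.span (\<Union>b\<in>root_line s - {0}. root_component b)) ` G"
      using s(2) b(2) by (intro image_eqI[of _ _ s]) simp_all
  qed
qed (use finite_group in simp)

text \<open>Stated for any form-preserving \<open>x\<close> that maps roots to roots, because it is
  applied to a normal subgroup with \<open>x\<close> taken from the larger group.\<close>

lemma root_component_image_subset:
  assumes "\<And>v w. herm (x *v v) (x *v w) = herm v w"
    and "\<And>c. c \<in> group_roots G \<Longrightarrow> x *v c \<in> group_roots G"
  shows "(*v) x ` root_component b \<subseteq> root_component (x *v b)"
proof
  fix v assume "v \<in> (*v) x ` root_component b"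
  then obtain c where c: "v = x *v c" "(b, c) \<in> root_adj\<^sup>*"
    by (auto simp: root_component_def)
  from c(2) have "(x *v b, x *v c) \<in> root_adj\<^sup>*"
  proof (induction rule: rtrancl_induct)
    case (step c d)
    then have "(x *v c, x *v d) \<in> root_adj"
      using assms by (auto simp: root_adj_def)
    then show ?case
      using step.IH by simp
  qed simp
  then show "v \<in> root_component (x *v b)"
    by (simp add: root_component_def c(1))
qed

text \<open>\<open>g *v w - w\<close> lies in the subspace and is a nonzero multiple of
  \<open>b\<close>.\<close>

lemma invariant_subspace_root:
  assumes "vec.subspace W" "\<And>g w. g \<in> G \<Longrightarrow> w \<in> W \<Longrightarrow> g *v w \<in> W"
    and "b \<in> group_roots G" "w \<in> W" "herm w b \<noteq> 0"
  shows "b \<in> W"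
proof -
  obtain g z where g: "b \<noteq> 0" "g \<in> G" "z \<noteq> 1" "refl_with b z g"
    using assms(3) by (auto simp: group_roots_iff)
  define c where "c = (z - 1) * herm w b / herm b b"
  have "c \<noteq> 0"
    using g(1,3) assms(5) by (simp add: c_def)
  have "g *v w - w \<in> W"
    using assms g(2) by (intro vec.subspace_diff) auto
  then have "c *s b \<in> W"
    by (simp add: refl_withD[OF g(4)] c_def)
  then have "(1 / c) *s (c *s b) \<in> W"
    using assms(1) by (rule vec.subspace_scale[rotated])
  then show ?thesis
    using \<open>c \<noteq> 0\<close> by simp
qed

lemma irreducible_of_spanning_component:
  assumes b: "b \<in> group_roots G" and span: "vec.span (root_component b) = UNIV"
  shows "irreducible_group G"
  unfolding irreducible_group_def
proof (intro allI impI)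
  fix W :: "(complex^'d) set"
  assume W: "vec.subspace W \<and> (\<forall>g\<in>G. \<forall>w\<in>W. g *v w \<in> W)"
  note root = invariant_subspace_root[of W]
  \<comment> \<open>An edge from a root in \<open>W\<close> leads to a root in \<open>W\<close>, by
    \<open>invariant_subspace_root\<close>; so \<open>W\<close> contains a component as soon as it
    meets it.\<close>
  have comp: "d \<in> W" if "c \<in> W" "d \<in> root_component c" for c d
  proof -
    have "(c, d) \<in> root_adj\<^sup>*"
      using that(2) by (simp add: root_component_def)
    then show ?thesis
    proof (induction rule: rtrancl_induct)
      case base
      then show ?case
        using that(1) .
    next
      case (step u v)
      then show ?case
        using root[of v u] W by (auto simp: root_adj_def)
    qed
  qed
  show "W = {0} \<or> W = UNIV"
  proof (cases "b \<in> W")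
    case True
    then have "vec.span (root_component b) \<subseteq> W"
      using comp W by (intro vec.span_minimal) auto
    then show ?thesis
      using span by auto
  next
    case False
    \<comment> \<open>No root of the component lies in \<open>W\<close>, so each is orthogonal to
      \<open>W\<close>; as they span the space, \<open>w\<close> is orthogonal to itself.\<close>
    have "w = 0" if w: "w \<in> W" for w
    proof -
      have "herm c w = 0" if c: "c \<in> root_component b" for c
      proof -
        have "c \<notin> W"
          using False comp root_component_sym[OF c] by blast
        then show ?thesis
          using root[of c w] W w root_component_roots[OF b c] herm_eq_0_commute by blast
      qed
      then have "vec.span (root_component b) \<subseteq> {v. herm v w = 0}"
        by (intro vec.span_minimal subspace_herm_left) auto
      then have "herm w w = 0"
        using span by blast
      then show ?thesis
        by simp
    qed
    then show ?thesis
      using W vec.subspace_0[of W] by auto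
  qed
qed

section \<open>Roots of a normal reflection subgroup and primitivity\<close>

lemma unitary_group_nrs:
  assumes "N \<in> normal_reflection_subgroups G"
  shows "unitary_group N"
  using nrs_D(1,2)[OF assms] finite_group unitary by (intro unitary_group.intro) (auto intro: finite_subset)

lemma nrs_roots_invariant:
  assumes "N \<in> normal_reflection_subgroups G" "g \<in> G" "b \<in> group_roots N"
  shows "g *v b \<in> group_roots N"
proof -
  interpret N: unitary_group N
    using unitary_group_nrs[OF assms(1)] .
  obtain s z where s: "b \<noteq> 0" "s \<in> N" "z \<noteq> 1" "refl_with b z s"
    using assms(3) by (auto simp: N.group_roots_iff)
  then have "refl_with (g *v b) z (g ** s ** inv\<^bsub>GL\<^esub> g)" "g ** s ** inv\<^bsub>GL\<^esub> g \<in> N"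
    using refl_with_conjugate[OF s(4) unitary[OF assms(2)]] nrs_D(3)[OF assms(1,2) s(2)] by auto
  moreover have "g *v b \<noteq> 0"
    using invertible_vector_mult_eq_0[OF group_D(1)[OF assms(2)]] s(1) by simp
  ultimately show ?thesis
    using s(3) unfolding N.group_roots_iff by blast
qed

lemma nrs_roots_nonempty:
  assumes "N \<in> normal_reflection_subgroups G" "N \<noteq> {mat 1}"
  shows "\<exists>b. b \<in> group_roots N"
proof -
  interpret N: unitary_group N
    using unitary_group_nrs[OF assms(1)] .
  have "\<exists>s\<in>N. reflection s"
  proof (rule ccontr)
    assume "\<not> (\<exists>s\<in>N. reflection s)"
    then have no_refl: "{s\<in>N. reflection s} = {}"
      by blast
    have "generate GL {} = N"
      using nrs_D(4)[OF assms(1)] unfolding no_refl .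
    then show False
      using assms(2) by (simp add: GL.generate_empty)
  qed
  then obtain s where s: "s \<in> N" "reflection s"
    by blast
  then obtain b z where "b \<noteq> 0" "z \<noteq> 1" "refl_with b z s"
    using reflection_refl_with[OF N.unitary] by blast
  then show ?thesis
    using s(1) N.group_roots_iff by blast
qed

lemma primitive_nrs_irreducible:
  assumes prim: "primitive_group G" and N: "N \<in> normal_reflection_subgroups G" "N \<noteq> {mat 1}"
  shows "irreducible_group N"
proof -
  interpret N: unitary_group N
    using unitary_group_nrs[OF N(1)] .
  define \<V> where "\<V> = (\<lambda>b. vec.span (N.root_component b)) ` group_roots N"
  obtain b where b: "b \<in> group_roots N"
    using nrs_roots_nonempty[OF N] by blast
  then have "b \<noteq> 0"
    by (simp add: group_roots_def)
  \<comment> \<open>Applying \<open>root_component_image_subset\<close> to the inverse of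
    \<open>g\<close> as well gives the opposite inclusion, so \<open>g\<close> permutes the
    components.\<close>
  have image: "(*v) g ` N.root_component c = N.root_component (g *v c)" if g: "g \<in> G" for g c
  proof
    note sub = N.root_component_image_subset[OF herm_invariant nrs_roots_invariant[OF N(1)]]
    show "(*v) g ` N.root_component c \<subseteq> N.root_component (g *v c)"
      using sub[OF g g] .
    have "(*v) (inv\<^bsub>GL\<^esub> g) ` N.root_component (g *v c) \<subseteq> N.root_component c"
      using sub[OF group_D(4)[OF g] group_D(4)[OF g], of "g *v c"] GL_inv_vector_mult(1)[OF group_D(1)[OF g]]
      by simp
    then have "(*v) g ` (*v) (inv\<^bsub>GL\<^esub> g) ` N.root_component (g *v c) \<subseteq> (*v) g ` N.root_component c"
      by (rule image_mono)
    then show "N.root_component (g *v c) \<subseteq> (*v) g ` N.root_component c"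
      using GL_inv_vector_mult(2)[OF group_D(1)[OF g]] by (simp add: image_image)
  qed
  \<comment> \<open>Normality makes this span invariant under \<open>G\<close>, and it is nonzero;
    irreducibility of \<open>G\<close> leaves only the whole space.\<close>
  have "vec.span (group_roots N) = UNIV"
  proof -
    have "g *v w \<in> vec.span (group_roots N)" if g: "g \<in> G" and w: "w \<in> vec.span (group_roots N)" for g w
    proof -
      have "g *v w \<in> vec.span ((*v) g ` group_roots N)"
        using w vector_mult_span_image[of g "group_roots N"] by blast
      also have "\<dots> \<subseteq> vec.span (group_roots N)"
        using nrs_roots_invariant[OF N(1) g] by (intro vec.span_mono) auto
      finally show ?thesis .
    qed
    moreover have "irreducible_group G"
      using prim by (simp add: primitive_group_def)
    ultimately have "vec.span (group_roots N) = {0} \<or> vec.span (group_roots N) = UNIV"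
      unfolding irreducible_group_def using vec.subspace_span[of "group_roots N"] by simp
    then show ?thesis
      using vec.span_base[OF b] \<open>b \<noteq> 0\<close> by auto
  qed
  moreover have "group_roots N \<subseteq> \<Union>\<V>"
  proof
    fix c assume "c \<in> group_roots N"
    then show "c \<in> \<Union>\<V>"
      unfolding \<V>_def using vec.span_base[OF N.root_component_self] by blast
  qed
  then have "vec.span (group_roots N) \<subseteq> vec.span (\<Union>\<V>)"
    by (rule vec.span_mono)
  ultimately have span: "vec.span (\<Union>\<V>) = UNIV"
    by blast
  have "system_of_imprimitivity G \<V>"
    unfolding system_of_imprimitivity_def
  proof (intro conjI ballI allI)
    show fin: "finite \<V>"
      unfolding \<V>_def by (rule N.finite_root_components)
    fix V assume "V \<in> \<V>"
    then obtain c where c: "c \<in> group_roots N" "V = vec.span (N.root_component c)"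
      by (auto simp: \<V>_def)
    show "vec.subspace V"
      by (simp add: c(2))
    have "c \<in> V" "c \<noteq> 0"
      using c vec.span_base[OF N.root_component_self] by (auto simp: group_roots_def)
    then show "V \<noteq> {0}"
      by auto
    fix g assume g: "g \<in> G"
    show "(*v) g ` V \<in> \<V>"
      using nrs_roots_invariant[OF N(1) g c(1)]
      by (simp add: c(2) vector_mult_span_image image[OF g] \<V>_def)
  next
    fix v
    show "\<exists>!f. f \<in> (\<Pi>\<^sub>E V\<in>\<V>. V) \<and> v = (\<Sum>V\<in>\<V>. f V)"
    proof (rule direct_sum_of_orthogonal_subspaces[OF _ _ _ span])
      show "finite \<V>"
        unfolding \<V>_def by (rule N.finite_root_components)
      show "vec.subspace V" if "V \<in> \<V>" for V
        using that by (auto simp: \<V>_def)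
      fix V W x y assume VW: "V \<in> \<V>" "W \<in> \<V>" "V \<noteq> W" and xy: "x \<in> V" "y \<in> W"
      then obtain c d where c: "c \<in> group_roots N" "V = vec.span (N.root_component c)"
        and d: "d \<in> group_roots N" "W = vec.span (N.root_component d)"
        by (auto simp: \<V>_def)
      have "d \<notin> N.root_component c"
        using VW(3) N.root_component_eq[of d c] by (auto simp: c(2) d(2))
      then show "herm x y = 0"
        using N.root_component_orthogonal[OF c(1) d(1)] xy c(2) d(2) by simp
    qed
  qed
  then have "\<V> = {UNIV}"
    using prim by (simp add: primitive_group_def)
  moreover have "vec.span (N.root_component b) \<in> \<V>"
    using b by (simp add: \<V>_def)
  ultimately have "vec.span (N.root_component b) = UNIV"
    by simp
  then show ?thesis
    using N.irreducible_of_spanning_component[OF b] by blast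
qed

end

theorem theorem2p1:
  fixes G :: "(complex^'d^'d) set"
    and m :: nat
    and a :: "nat \<Rightarrow> complex^'d"
    and k :: "nat \<Rightarrow> nat"
  assumes "complex_reflection_group G"
    and "irreducible_group G"
    and "\<And>j. j \<in> {1..m} \<Longrightarrow> a j \<in> group_roots G"
    and "bij_betw (\<lambda>j. conj_orbit G (refl_subgroup G (a j))) {1..m}
           {conj_orbit G (refl_subgroup G b) | b. b \<in> group_roots G}"
    and "\<And>j. j \<in> {1..m} \<Longrightarrow> k j = card (refl_subgroup G (a j))"
  shows "lattice_iso (normal_power G m a) (divisor_order m k) (nrs_order G)
    \<and> (\<forall>M\<in>normal_reflection_subgroups G. \<forall>N\<in>normal_reflection_subgroups G.
         M \<sqinter>\<^bsub>nrs_order G\<^esub> N = nrs_meet M N \<and> M \<squnion>\<^bsub>nrs_order G\<^esub> N = nrs_join M N)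
    \<and> (\<forall>\<alpha>\<in>divisor_tuples m k. \<forall>\<beta>\<in>divisor_tuples m k.
         nrs_meet (normal_power G m a \<alpha>) (normal_power G m a \<beta>)
           = normal_power G m a (gcd_tuple m \<alpha> \<beta>)
       \<and> nrs_join (normal_power G m a \<alpha>) (normal_power G m a \<beta>)
           = normal_power G m a \<alpha> <#>\<^bsub>GL\<^esub> normal_power G m a \<beta>
       \<and> normal_power G m a \<alpha> <#>\<^bsub>GL\<^esub> normal_power G m a \<beta>
           = normal_power G m a (lcm_tuple m \<alpha> \<beta>))
    \<and> card (normal_reflection_subgroups G) = (\<Prod>j\<in>{1..m}. sigma0 (k j))
    \<and> (primitive_group G \<longrightarrow>
         (\<forall>N\<in>normal_reflection_subgroups G. N \<noteq> {mat 1} \<longrightarrow> irreducible_group N))"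
proof -
  interpret reflection_orbits G m a k
  proof (intro reflection_orbits.intro unitary_group.intro reflection_orbits_axioms.intro)
    show "subgroup G GL" "finite G"
      using assms(1) by (auto simp: complex_reflection_group_def generated_by_reflections_subgroup)
    show "unitary g" if "g \<in> G" for g
      using assms(1) that by (simp add: complex_reflection_group_def)
  qed (use assms(3-5) in auto)
  have "lattice_iso (normal_power G m a) (divisor_order m k) (nrs_order G)"
    unfolding lattice_iso_def
    using lattice_divisor_order lattice_nrs_order bij_betw_normal_power normal_power_subset_iff
    by (simp add: divisor_order_def nrs_order_def)
  moreover have "nrs_join (normal_power G m a \<alpha>) (normal_power G m a \<beta>)
      = normal_power G m a \<alpha> <#>\<^bsub>GL\<^esub> normal_power G m a \<beta>"
    if "\<alpha> \<in> divisor_tuples m k" "\<beta> \<in> divisor_tuples m k" for \<alpha> \<beta>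
    using that by (intro nrs_join_eq_set_mult normal_power_nrs)
  ultimately show ?thesis
    using lattice_nrs_order nrs_meet_normal_power nrs_join_normal_power card_nrs primitive_nrs_irreducible
    by auto
qed

end
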